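(* Let $n\ge 3$ be an integer and let $G$ be a connected simple graph with $n$ vertices and $m$ edges. Then \[ \mathrm{unc}(G)\;\ge\;\left\lceil\frac{m}{3n-6-\sqrt{2m}+\sqrt{6(n-2)}}\right\rceil . \]
   Context: A drawing of a graph $G$ in the plane represents vertices by distinct points and each edge by a simple continuous arc joining its endpoints, passing through no other vertex; any two edges share finitely many points, no two edges touch at an interior point, and no three edges share a common interior point. A crossing is a common interior point of two distinct edges. An edge is uncrossed in a drawing if it has no crossing with any other edge. An uncrossed collection of $G$ is a collection $\mathcal{D}$ of drawings of $G$ such that every edge of $G$ is uncrossed in at least one drawing of $\mathcal{D}$. The uncrossed number $\mathrm{unc}(G)$ is the minimum size of an uncrossed collection of $G$. *)

theory Defs
  imports "HOL-Analysis.Analysis" "HOL-Library.Extended_Nat"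
begin

definition simple_graph :: "'a set \<Rightarrow> 'a set set \<Rightarrow> bool" where
  "simple_graph V E \<longleftrightarrow> finite V \<and> (\<forall>e\<in>E. e \<subseteq> V \<and> card e = 2)"

definition connected_graph :: "'a set \<Rightarrow> 'a set set \<Rightarrow> bool" where
  "connected_graph V E \<longleftrightarrow>
     V \<noteq> {} \<and> (\<forall>u\<in>V. \<forall>v\<in>V. (u, v) \<in> {(x, y). {x, y} \<in> E}\<^sup>*)"

text \<open>The plane is \<^typ>\<open>complex\<close>. A drawing is a pair: the position of each vertex, and for each
  edge a parametrised arc, whose orientation is irrelevant.\<close>

type_synonym 'a drawing = "('a \<Rightarrow> complex) \<times> ('a set \<Rightarrow> real \<Rightarrow> complex)"

definition arc_interior :: "(real \<Rightarrow> complex) \<Rightarrow> complex set" where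
  "arc_interior g = path_image g - {pathstart g, pathfinish g}"

text \<open>Two arcs meeting at an interior point \<open>p\<close> cross there, as opposed to touching, if some
  homeomorphism from a neighbourhood of \<open>p\<close> onto the open unit disc takes them to the horizontal
  and the vertical diameter.\<close>

definition cross_at :: "(real \<Rightarrow> complex) \<Rightarrow> (real \<Rightarrow> complex) \<Rightarrow> complex \<Rightarrow> bool" where
  "cross_at g1 g2 p \<longleftrightarrow>
     (\<exists>U h k. open U \<and> p \<in> U \<and> homeomorphism U (ball 0 1) h k \<and> h p = 0 \<and>
        h ` (path_image g1 \<inter> U) = {z \<in> ball 0 1. Im z = 0} \<and>
        h ` (path_image g2 \<inter> U) = {z \<in> ball 0 1. Re z = 0})"

definition is_drawing :: "'a set \<Rightarrow> 'a set set \<Rightarrow> 'a drawing \<Rightarrow> bool" where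
  "is_drawing V E D \<longleftrightarrow> (case D of (pos, crv) \<Rightarrow>
     inj_on pos V \<and>
     (\<forall>e\<in>E. arc (crv e) \<and> {pathstart (crv e), pathfinish (crv e)} = pos ` e \<and>
        path_image (crv e) \<inter> pos ` V = pos ` e) \<and>
     (\<forall>e\<in>E. \<forall>f\<in>E. e \<noteq> f \<longrightarrow> finite (path_image (crv e) \<inter> path_image (crv f))) \<and>
     (\<forall>e\<in>E. \<forall>f\<in>E. e \<noteq> f \<longrightarrow>
        (\<forall>p \<in> arc_interior (crv e) \<inter> arc_interior (crv f). cross_at (crv e) (crv f) p)) \<and>
     (\<forall>e\<in>E. \<forall>f\<in>E. \<forall>g\<in>E. e \<noteq> f \<and> f \<noteq> g \<and> e \<noteq> g \<longrightarrow>
        arc_interior (crv e) \<inter> arc_interior (crv f) \<inter> arc_interior (crv g) = {}))"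

definition uncrossed_in :: "'a set set \<Rightarrow> 'a drawing \<Rightarrow> 'a set \<Rightarrow> bool" where
  "uncrossed_in E D e \<longleftrightarrow>
     (\<forall>f\<in>E. f \<noteq> e \<longrightarrow> arc_interior (snd D e) \<inter> arc_interior (snd D f) = {})"

definition uncrossed_collection ::
    "'a set \<Rightarrow> 'a set set \<Rightarrow> 'a drawing set \<Rightarrow> bool" where
  "uncrossed_collection V E \<D> \<longleftrightarrow>
     (\<forall>D\<in>\<D>. is_drawing V E D) \<and> (\<forall>e\<in>E. \<exists>D\<in>\<D>. uncrossed_in E D e)"

text \<open>An infimum over a set of elements of \<^typ>\<open>enat\<close> is attained as soon as the set is nonempty,
  so this is a minimum.\<close>

definition uncrossed_number :: "'a set \<Rightarrow> 'a set set \<Rightarrow> enat" where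
  "uncrossed_number V E =
     (INF \<D> \<in> {\<D>. finite \<D> \<and> uncrossed_collection V E \<D>}. enat (card \<D>))"

end

theory Submission
  imports Defs
begin

text \<open>It suffices to bound the number \<open>h\<close> of uncrossed edges of a single drawing. Put
  \<open>t = 3n - 6 - h\<close> and \<open>s = sqrt (6(n-2))\<close>; the claim is \<open>2m \<le> (t + s)\<^sup>2\<close>.

  The interiors of the crossed edges form a set whose path components we call clusters; the edges of a
  cluster \<open>U\<close> have \<open>a(U) \<ge> 3\<close> endpoints in total. If \<open>a(U) \<ge> 4\<close>, a tree inside \<open>U\<close> serves as a new (fat)
  vertex joined to all these endpoints without crossings; if \<open>a(U) = 3\<close>, one edge of the cluster is kept. The
  result is still plane and simple, so Euler's inequality yields \<open>h + (\<Sum>U. d(U)) \<le> 3n - 6\<close> with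
  \<open>d(U) = max 1 (a(U) - 3)\<close>. Since \<open>U\<close> has at most \<open>a(U) choose 2\<close> edges, the number of crossed edges
  is at most \<open>(t\<^sup>2 + 11t)/2\<close>, which is good enough for \<open>n \<ge> 6\<close>; smaller \<open>n\<close> are immediate.

  Euler's inequality for graphs drawn with arbitrary arcs and fat vertices is obtained from the Jordan curve
  theorem (an edge closing a cycle increases the number of faces) and from Janiszewski's theorem (an edge
  borders at most two faces, and a forest does not separate the plane).\<close>

section \<open>Arcs in the plane\<close>

lemma arc_image_eq_interior_Un:
  "path_image g = insert (pathstart g) (insert (pathfinish g) (arc_interior g))"
  by (auto simp: arc_interior_def)

lemma connected_arc_interior: "arc g \<Longrightarrow> connected (arc_interior g)"
  unfolding arc_interior_def by (intro connected_simple_path_endless arc_imp_simple_path)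

lemma arc_interior_nonempty: "arc g \<Longrightarrow> arc_interior g \<noteq> {}"
  by (metis arc_interior_def arc_imp_simple_path simple_path_endless nonempty_simple_path_endless)

text \<open>Removing a point leaves a disc connected, but not an interval. If the image contained a
  disc, the inverse of \<open>g\<close> would carry the punctured disc to a connected set of
  parameters that misses \<open>t\<close> and yet has elements on both sides of it.\<close>

lemma empty_interior_arc_image:
  fixes g :: "real \<Rightarrow> complex"
  assumes "arc g" shows "interior (path_image g) = {}"
proof (rule ccontr)
  assume "interior (path_image g) \<noteq> {}"
  then obtain z r where r: "r > 0" "ball z r \<subseteq> path_image g"
    by (metis equals0I mem_interior)
  \<comment> \<open>Infinitely many points leave room to choose \<open>p\<close> away from both ends
    of the arc, so that its parameter \<open>t\<close> is strictly between 0 and 1.\<close>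
  have "infinite (ball z r)"
    using r(1) finite_imp_not_open[of "ball z r"] by (auto simp: not_open_singleton)
  then have "infinite (ball z r - {g 0, g 1})" by simp
  then obtain p where p: "p \<in> ball z r" "p \<noteq> g 0" "p \<noteq> g 1"
    by (metis Diff_iff finite.emptyI insertCI ex_in_conv)
  then obtain t where t: "t \<in> {0..1}" "p = g t"
    using r by (auto simp: path_image_def)
  with p have t01: "0 < t" "t < 1" by (auto simp: order.strict_iff_order)
  have cg: "continuous_on {0..1} g" and inj: "inj_on g {0..1}"
    using assms by (auto simp: arc_def path_def)
  define k where "k = the_inv_into {0..1} g"
  have ck: "continuous_on (path_image g) k"
    unfolding k_def path_image_def using cg inj by (intro continuous_on_inv_into) auto
  have kg: "k (g s) = s" if "s \<in> {0..1}" for s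
    unfolding k_def using inj that by (simp add: the_inv_into_f_f)
  have "connected (ball z r - {p})"
    by (intro connected_open_delete) auto
  then have con: "connected (k ` (ball z r - {p}))"
    using ck r by (meson Diff_subset connected_continuous_image continuous_on_subset order_trans)
  have tn: "t \<notin> k ` (ball z r - {p})"
    using r(2) kg t by (auto simp: path_image_def subset_iff)
  have "\<exists>d>0. \<forall>s\<in>{0..1}. dist s t < d \<longrightarrow> g s \<in> ball z r"
  proof -
    have "openin (top_of_set {0..1}) ({0..1} \<inter> g -` ball z r)"
      using cg by (simp add: continuous_openin_preimage_gen)
    moreover have "t \<in> {0..1} \<inter> g -` ball z r" using t p by simp
    ultimately obtain d where "d > 0" "\<forall>s\<in>{0..1}. dist s t < d \<longrightarrow> s \<in> {0..1} \<inter> g -` ball z r"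
      unfolding openin_euclidean_subtopology_iff by blast
    then show ?thesis by auto
  qed
  then obtain d where d: "d > 0" "\<And>s. s \<in> {0..1} \<Longrightarrow> dist s t < d \<Longrightarrow> g s \<in> ball z r" by auto
  define e where "e = min (d/2) (min t (1 - t))"
  have e: "0 < e" "e < d" "e \<le> t" "e \<le> 1 - t" using d t01 by (auto simp: e_def)
  have mem: "s \<in> k ` (ball z r - {p})" if "s \<in> {0..1}" "dist s t < d" "s \<noteq> t" for s
  proof -
    have "g s \<noteq> p" using that t inj by (auto simp: inj_on_def)
    then show ?thesis using d(2)[OF that(1,2)] kg[OF that(1)] by force
  qed
  have "t - e \<in> k ` (ball z r - {p})" "t + e \<in> k ` (ball z r - {p})"
    using e t01 by (auto intro!: mem simp: dist_real_def)
  then have "t \<in> k ` (ball z r - {p})"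
    using con e unfolding connected_iff_interval by (metis add_increasing2 less_eq_real_def diff_le_eq)
  then show False using tn by blast
qed

text \<open>In the applications \<open>S\<close> is the part of a graph already drawn,
  \<open>e\<close> is a further edge that closes a cycle, and \<open>g\<close> is a way back inside
  \<open>S\<close>, so that \<open>e\<close> and \<open>g\<close> form a Jordan curve.\<close>

locale closing_arc =
  fixes S :: "complex set" and e g :: "real \<Rightarrow> complex"
  assumes S: "closed S" and e: "arc e" and g: "arc g"
    and eS: "path_image e \<inter> S = {pathstart e, pathfinish e}"
    and gS: "path_image g \<subseteq> S"
    and ge: "pathstart g = pathfinish e" "pathfinish g = pathstart e"
begin

definition J where "J = path_image e \<union> path_image g"

lemma simple_closed: "simple_path (e +++ g)" "pathfinish (e +++ g) = pathstart (e +++ g)"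
    "path_image (e +++ g) = J"
  using simple_path_join_loop[of e g] e g eS gS ge by (auto simp: J_def path_image_join)

lemmas jordan = Jordan_inside_outside[OF simple_closed(1,2), unfolded simple_closed(3)]

text \<open>By the Jordan curve theorem each point of \<open>J\<close> is on the frontier of the
  inside and of the outside. This is why an edge closing a cycle splits a face.\<close>

lemma both_sides:
  assumes "p \<in> path_image e" "open U" "p \<in> U"
  shows "U \<inter> inside J \<noteq> {}" "U \<inter> outside J \<noteq> {}"
proof -
  have "p \<in> closure (inside J)" "p \<in> closure (outside J)"
    using jordan assms(1) unfolding frontier_def J_def by auto
  then show "U \<inter> inside J \<noteq> {}" "U \<inter> outside J \<noteq> {}"
    using assms by (auto simp: open_Int_closure_eq_empty[OF assms(2)] dest: closure_iff_nhds_not_empty[THEN iffD1])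
qed

text \<open>Janiszewski's theorem for \<open>J\<close> and \<open>S\<close>, whose intersection is
  the arc \<open>g\<close> and hence connected: two points separated neither by \<open>J\<close> nor
  by \<open>S\<close> are not separated by the union.\<close>

lemma same_side:
  assumes C: "connected C" "C \<subseteq> - J" and ab: "a \<in> C" "b \<in> C" "connected_component (- S) a b"
  shows "connected_component (- (S \<union> path_image e)) a b"
proof -
  have "connected_component (- (J \<union> S)) a b"
  proof (rule Janiszewski)
    show "compact J" unfolding J_def using e g by (simp add: compact_Un compact_arc_image)
    have "J \<inter> S = path_image g" unfolding J_def using eS gS ge
      by (metis Int_Un_distrib2 Un_absorb1 inf.absorb1 insert_subset pathfinish_in_path_image pathstart_in_path_image bot_least)
    then show "connected (J \<inter> S)" using g by (simp add: connected_arc_image)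
    show "connected_component (- J) a b" using C ab by (meson connected_component_def)
  qed (use S ab in auto)
  moreover have "J \<union> S = S \<union> path_image e" using gS by (auto simp: J_def)
  ultimately show ?thesis by simp
qed

end

text \<open>Janiszewski's theorem twice: the arc meets \<open>S\<close> in \<open>u\<close> only,
  and the union of both meets \<open>T\<close> in \<open>v\<close> only. In the application the arc
  is an edge between two parts of a graph that are otherwise not joined.\<close>

lemma connected_component_bridge:
  fixes S T :: "complex set"
  assumes "compact S" "compact T" "S \<inter> T = {}" "arc e"
    and "path_image e \<inter> S = {u}" "path_image e \<inter> T = {v}"
    and con: "connected_component (- (S \<union> T)) a b"
    and ab: "a \<notin> path_image e" "b \<notin> path_image e"
  shows "connected_component (- (S \<union> T \<union> path_image e)) a b"
proof -
  have mono: "connected_component (- S) a b" "connected_component (- T) a b"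
    using con by (auto elim: connected_component_of_subset)
  have "connected (- path_image e)"
    using assms(4) by (simp add: connected_arc_complement)
  then have "connected_component (- path_image e) a b"
    using ab by (meson ComplI connected_iff_connected_component)
  then have "connected_component (- (S \<union> path_image e)) a b"
    using assms mono by (intro Janiszewski) (auto simp: Int_commute closed_arc_image)
  then have "connected_component (- ((S \<union> path_image e) \<union> T)) a b"
    using assms mono
    by (intro Janiszewski[where S = "S \<union> path_image e" and T = T])
      (auto simp: Int_Un_distrib2 compact_Un compact_arc_image compact_imp_closed simp del: Compl_Un)
  then show ?thesis by (simp add: Un_ac)
qed

lemma arc_interior_image: "arc g \<Longrightarrow> arc_interior g = g ` {0<..<1}"
  unfolding arc_interior_def by (simp add: simple_path_endless arc_imp_simple_path)

lemma arc_interior_subpath_0: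
  assumes "arc g" "0 < t" "t \<le> 1"
  shows "arc_interior (subpath 0 t g) = g ` {0<..<t}"
proof -
  have "arc (subpath 0 t g)" using assms by (intro arc_subpath_arc) auto
  then have "arc_interior (subpath 0 t g) = (\<lambda>x. g (t * x)) ` {0<..<1}"
    by (simp add: arc_interior_image subpath_def)
  also have "\<dots> = g ` ((*) t ` {0<..<1})" by (simp add: image_image)
  also have "(*) t ` {0<..<1} = {0<..<t}" 
  proof
    show "{0<..<t} \<subseteq> (*) t ` {0<..<1}"
    proof
      fix x assume "x \<in> {0<..<t}"
      then show "x \<in> (*) t ` {0<..<1}" using assms(2) by (intro image_eqI[of _ _ "x / t"]) auto
    qed
  qed (use assms(2) in auto)
  finally show ?thesis .
qed

lemma path_connected_arc_interior: "arc g \<Longrightarrow> path_connected (arc_interior g)"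
  unfolding arc_interior_image
  by (intro path_connected_continuous_image convex_imp_path_connected)
    (auto simp: arc_def path_def intro: continuous_on_subset)

text \<open>The set is the image of a half-open parameter interval. It makes a vertex accessible
  from the cluster of a crossed edge incident with it.\<close>

lemma path_connected_insert_arc_interior:
  assumes "arc g" "c \<in> {pathstart g, pathfinish g}"
  shows "path_connected (insert c (arc_interior g))"
proof -
  have cont: "continuous_on {0..1} g" using assms(1) by (auto simp: arc_def path_def)
  have "path_connected (g ` {0..<1})" "path_connected (g ` {0<..1})"
    by (intro path_connected_continuous_image convex_imp_path_connected continuous_on_subset[OF cont]; auto)+
  moreover have "{0..<1} = insert 0 {0<..<1::real}" "{0<..1} = insert 1 {0<..<1::real}" by auto
  ultimately show ?thesis
    using assms by (auto simp: arc_interior_image pathstart_def pathfinish_def)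
qed

section \<open>Euler's inequality for plane graphs with fat vertices\<close>

text \<open>Sending a class of \<open>r\<close> to the class of \<open>s\<close> around it is onto,
  and remains so without the class of \<open>a\<close>, because that of \<open>b\<close> has the
  same image. The classes will be the components of a graph before and after an edge joins two of
  them.\<close>

lemma card_classes_less:
  assumes "finite Q" "a \<in> Q" "b \<in> Q" "equiv UNIV r" "equiv UNIV s" "r \<subseteq> s"
    and ab: "(a, b) \<in> s" "(a, b) \<notin> r"
  shows "card ((\<lambda>x. s `` {x}) ` Q) < card ((\<lambda>x. r `` {x}) ` Q)"
proof -
  let ?R = "(\<lambda>x. r `` {x}) ` Q"
  have h: "s `` (r `` {x}) = s `` {x}" for x
    using assms(4-6) by (auto simp: equiv_def refl_on_def dest: transD subsetD)
  have ne: "r `` {a} \<noteq> r `` {b}" "s `` {a} = s `` {b}"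
    using ab assms(4,5) by (auto simp: eq_equiv_class_iff)
  have "(\<lambda>x. s `` {x}) ` Q \<subseteq> (\<lambda>c. s `` c) ` (?R - {r `` {a}})"
  proof clarify
    fix x assume x: "x \<in> Q"
    define y where "y = (if r `` {x} = r `` {a} then b else x)"
    have "s `` {x} = s `` {a}" if "r `` {x} = r `` {a}" using h that by metis
    then have "s `` {x} = s `` (r `` {y})" using ne h by (simp add: y_def)
    moreover have "r `` {y} \<in> ?R - {r `` {a}}" using x ne assms(3) by (auto simp: y_def)
    ultimately show "s `` {x} \<in> (\<lambda>c. s `` c) ` (?R - {r `` {a}})" by blast
  qed
  then have "card ((\<lambda>x. s `` {x}) ` Q) \<le> card (?R - {r `` {a}})"
    using assms(1) by (meson card_image_le card_mono finite_Diff finite_imageI le_trans)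
  also have "\<dots> < card ?R" using assms(1,2) by (intro card_Diff1_less) auto
  finally show ?thesis .
qed

lemma components_eq_connected_component_set:
  "C \<in> components S \<Longrightarrow> x \<in> C \<Longrightarrow> C = connected_component_set S x"
  by (metis components_iff connected_component_eq)

text \<open>Each component of \<open>- T\<close> lies inside a component of \<open>- S\<close>, so
  points of different faces stay in different faces. Drawing an additional edge thus never lowers
  the number of faces, as long as every face keeps a point.\<close>

lemma refine_components:
  fixes S T :: "'a::topological_space set"
  assumes \<Phi>: "\<Phi> \<subseteq> components (- S)" and "S \<subseteq> T" and x: "\<And>\<psi>. \<psi> \<in> \<Phi> \<Longrightarrow> x \<psi> \<in> \<psi> - T"
  shows "(\<lambda>\<psi>. connected_component_set (- T) (x \<psi>)) ` \<Phi> \<subseteq> components (- T)"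
    and "inj_on (\<lambda>\<psi>. connected_component_set (- T) (x \<psi>)) \<Phi>"
proof -
  show "(\<lambda>\<psi>. connected_component_set (- T) (x \<psi>)) ` \<Phi> \<subseteq> components (- T)"
    using x by (auto intro: componentsI)
  have sub: "\<psi> = connected_component_set (- S) (x \<psi>)" if "\<psi> \<in> \<Phi>" for \<psi>
    using components_eq_connected_component_set that \<Phi> x by blast
  show "inj_on (\<lambda>\<psi>. connected_component_set (- T) (x \<psi>)) \<Phi>"
  proof (rule inj_onI)
    fix \<psi> \<psi>' assume *: "\<psi> \<in> \<Phi>" "\<psi>' \<in> \<Phi>"
      and eq: "connected_component_set (- T) (x \<psi>) = connected_component_set (- T) (x \<psi>')"
    have "connected_component (- T) (x \<psi>) (x \<psi>')"
      using eq x[OF *(2)] by (metis ComplI Diff_iff connected_component_refl mem_Collect_eq)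
    then have "connected_component (- S) (x \<psi>) (x \<psi>')"
      by (rule connected_component_of_subset) (use \<open>S \<subseteq> T\<close> in auto)
    then show "\<psi> = \<psi>'"
      using sub[OF *(1)] sub[OF *(2)] by (metis connected_component_eq mem_Collect_eq)
  qed
qed

text \<open>A simple graph drawn without crossings whose vertices are disjoint non-separating continua \<open>K q\<close>.\<close>

locale fat_plane_graph =
  fixes Q :: "'q set" and K :: "'q \<Rightarrow> complex set"
    and I :: "'i set" and ends :: "'i \<Rightarrow> 'q set" and \<gamma> :: "'i \<Rightarrow> real \<Rightarrow> complex"
  assumes finite_Q: "finite Q" and finite_I: "finite I"
    and compact_K: "q \<in> Q \<Longrightarrow> compact (K q)"
    and path_connected_K: "q \<in> Q \<Longrightarrow> path_connected (K q)"
    and connected_compl_K: "q \<in> Q \<Longrightarrow> connected (- K q)"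
    and disjoint_K: "q \<in> Q \<Longrightarrow> r \<in> Q \<Longrightarrow> q \<noteq> r \<Longrightarrow> K q \<inter> K r = {}"
    and arc_\<gamma>: "i \<in> I \<Longrightarrow> arc (\<gamma> i)"
    and ends: "i \<in> I \<Longrightarrow> \<exists>a\<in>Q. \<exists>b\<in>Q. a \<noteq> b \<and> ends i = {a, b} \<and>
        pathstart (\<gamma> i) \<in> K a \<and> pathfinish (\<gamma> i) \<in> K b"
    and inj_ends: "inj_on ends I"
    and interior_K: "i \<in> I \<Longrightarrow> q \<in> Q \<Longrightarrow> arc_interior (\<gamma> i) \<inter> K q = {}"
    and interior_disjoint: "i \<in> I \<Longrightarrow> j \<in> I \<Longrightarrow> i \<noteq> j \<Longrightarrow> arc_interior (\<gamma> i) \<inter> arc_interior (\<gamma> j) = {}"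
begin

section \<open>Connectivity and cycles in the abstract graph\<close>

definition body :: "'i set \<Rightarrow> complex set" where
  "body F = (\<Union>q\<in>Q. K q) \<union> (\<Union>i\<in>F. path_image (\<gamma> i))"

definition conn :: "'i set \<Rightarrow> ('q \<times> 'q) set" where
  "conn F = {(a, b). \<exists>i\<in>F. ends i = {a, b}}\<^sup>*"

text \<open>For \<open>i\<close> outside \<open>F\<close> this means that \<open>i\<close> completes
  a cycle with edges of \<open>F\<close>; so \<open>closes (I - {i}) i\<close> says that
  \<open>i\<close> is not a bridge of the whole graph.\<close>

definition closes :: "'i set \<Rightarrow> 'i \<Rightarrow> bool" where
  "closes F i \<longleftrightarrow> (\<forall>a\<in>ends i. \<forall>b\<in>ends i. (a, b) \<in> conn F)"

definition acyclic_edges :: "'i set \<Rightarrow> bool" where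
  "acyclic_edges F \<longleftrightarrow> (\<forall>i\<in>F. \<not> closes (F - {i}) i)"

lemma sym_conn: "sym (conn F)"
  unfolding conn_def by (rule sym_rtrancl) (auto simp: sym_def insert_commute)

lemma trans_conn: "trans (conn F)"
  unfolding conn_def by (rule trans_rtrancl)

lemma refl_conn [simp]: "(x, x) \<in> conn F"
  unfolding conn_def by simp

lemma conn_sym: "(x, y) \<in> conn F \<Longrightarrow> (y, x) \<in> conn F"
  using sym_conn by (rule symD)

lemma conn_trans: "(x, y) \<in> conn F \<Longrightarrow> (y, z) \<in> conn F \<Longrightarrow> (x, z) \<in> conn F"
  using trans_conn by (rule transD)

lemma equiv_conn: "equiv UNIV (conn F)"
  by (simp add: equiv_def refl_on_def sym_conn trans_conn)

lemma ends_pair: "i \<in> I \<Longrightarrow> \<exists>a b. ends i = {a, b} \<and> a \<noteq> b"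
  using ends by blast

lemma conn_mono: "F \<subseteq> G \<Longrightarrow> conn F \<subseteq> conn G"
  unfolding conn_def by (rule rtrancl_mono) auto

lemma conn_edge: "i \<in> F \<Longrightarrow> ends i = {a, b} \<Longrightarrow> (a, b) \<in> conn F"
  unfolding conn_def by (rule r_into_rtrancl) auto

lemma conn_empty: "conn {} = Id"
  unfolding conn_def by simp

lemma closesI: "ends i = {a, b} \<Longrightarrow> (a, b) \<in> conn F \<Longrightarrow> closes F i"
  unfolding closes_def using sym_conn[of F] by (auto dest: symD)

lemma closes_mono: "closes F i \<Longrightarrow> F \<subseteq> G \<Longrightarrow> closes G i"
  unfolding closes_def using conn_mono by blast

text \<open>A walk that uses \<open>i\<close> can be cut at its first and its last use of
  \<open>i\<close>; the outer pieces run in \<open>F\<close>.\<close>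

lemma conn_insertD:
  assumes "(x, y) \<in> conn (insert i F)" "ends i = {a, b}"
  shows "(x, y) \<in> conn F \<or>
    ((x, a) \<in> conn F \<or> (x, b) \<in> conn F) \<and> ((y, a) \<in> conn F \<or> (y, b) \<in> conn F)"
  using assms(1) unfolding conn_def[of "insert i F"]
proof (induction rule: rtrancl_induct)
  case (step y z)
  then obtain j where j: "j = i \<or> j \<in> F" "ends j = {y, z}" by auto
  show ?case
  proof (cases "j \<in> F")
    case True
    then have "(y, z) \<in> conn F" "(z, y) \<in> conn F"
      using j conn_edge[of j F] by (auto simp: insert_commute)
    then show ?thesis using step.IH by (metis conn_trans)
  next
    case False
    with j assms(2) have "{y, z} = {a, b}" by auto
    then consider "y = a" "z = b" | "y = b" "z = a" by (auto simp: doubleton_eq_iff)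
    then show ?thesis using step.IH by cases auto
  qed
qed auto

lemma conn_insert_closes:
  assumes "closes F i" "i \<in> I" shows "conn (insert i F) = conn F"
proof
  obtain a b where ab: "ends i = {a, b}" using ends_pair[OF assms(2)] by blast
  have *: "(a, b) \<in> conn F" "(b, a) \<in> conn F" using assms(1) ab unfolding closes_def by auto
  show "conn (insert i F) \<subseteq> conn F"
  proof clarify
    fix x y assume "(x, y) \<in> conn (insert i F)"
    from conn_insertD[OF this ab] *(1) show "(x, y) \<in> conn F"
      by (metis conn_sym conn_trans)
  qed
qed (rule conn_mono, auto)

text \<open>A smallest edge set that is not acyclic is a cycle, and each of its edges is closed by
  the others.\<close>

lemma cycle_edges:
  assumes "B \<subseteq> I" "\<not> acyclic_edges B"
  obtains Z where "Z \<subseteq> B" "card Z \<ge> 3" "\<And>i. i \<in> Z \<Longrightarrow> closes (Z - {i}) i"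
proof -
  have "finite B" using assms(1) finite_I by (rule finite_subset)
  obtain Z where Z: "Z \<subseteq> B \<and> \<not> acyclic_edges Z"
    and least: "\<And>Y. Y \<subseteq> B \<and> \<not> acyclic_edges Y \<Longrightarrow> card Z \<le> card Y"
    using ex_has_least_nat[of "\<lambda>Z. Z \<subseteq> B \<and> \<not> acyclic_edges Z" B card] assms(2) by blast
  have finZ: "finite Z" using Z \<open>finite B\<close> finite_subset by blast
  have ZI: "x \<in> I" if "x \<in> Z" for x using that Z assms(1) by blast
  have min: "acyclic_edges (Z - {j})" if "j \<in> Z" for j
    using least[of "Z - {j}"] Z card_Diff1_less[OF finZ that] by auto
  obtain i where i: "i \<in> Z" "closes (Z - {i}) i" using Z by (auto simp: acyclic_edges_def)
  obtain u v where uv: "ends i = {u, v}" "u \<noteq> v" using ends_pair[OF ZI[OF i(1)]] by blast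
  have uv_conn: "(u, v) \<in> conn (Z - {i})" using i(2) uv by (auto simp: closes_def)
  \<comment> \<open>The walk from \<open>u\<close> to \<open>v\<close> must use \<open>j\<close>,
    since \<open>Z - {j}\<close> is acyclic by minimality. Its outer pieces link the ends of
    \<open>j\<close> to \<open>u\<close> and \<open>v\<close>, and the edge \<open>i\<close> joins
    \<open>u\<close> to \<open>v\<close>, which bypasses \<open>j\<close>.\<close>
  have clo: "closes (Z - {j}) j" if j: "j \<in> Z" for j
  proof (cases "j = i")
    case False
    obtain a b where ab: "ends j = {a, b}" using ends_pair[OF ZI[OF j]] by blast
    define r where "r = conn (Z - {i} - {j})"
    have "\<not> closes (Z - {j} - {i}) i"
      using min[OF j] i False by (auto simp: acyclic_edges_def)
    then have nr: "(u, v) \<notin> r"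
      unfolding r_def using closesI[OF uv(1), of "Z - {i} - {j}"] by (auto simp: Diff_insert[symmetric] insert_commute)
    have "(u, v) \<in> conn (insert j (Z - {i} - {j}))"
      using uv_conn j False by (simp add: insert_absorb insert_Diff)
    from conn_insertD[OF this ab, folded r_def] nr
    have "((u, a) \<in> r \<or> (u, b) \<in> r) \<and> ((v, a) \<in> r \<or> (v, b) \<in> r)" by blast
    then have *: "(a, u) \<in> r \<and> (v, b) \<in> r \<or> (a, v) \<in> r \<and> (u, b) \<in> r"
      using nr conn_sym[of _ _ "Z - {i} - {j}", folded r_def] conn_trans[of _ _ "Z - {i} - {j}", folded r_def] by meson
    have sub: "(x, y) \<in> conn (Z - {j})" if "(x, y) \<in> r" for x y
      using that conn_mono[of "Z - {i} - {j}" "Z - {j}"] unfolding r_def by blast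
    have uv': "(u, v) \<in> conn (Z - {j})" "(v, u) \<in> conn (Z - {j})"
      using conn_edge[of i "Z - {j}"] uv(1) i False by (auto simp: insert_commute)
    have "(a, b) \<in> conn (Z - {j})"
      using * sub uv' conn_trans by meson
    then show ?thesis by (rule closesI[OF ab])
  qed (use i in simp)
  \<comment> \<open>A cycle with one edge would be a loop and one with two edges a pair of parallel
    edges; these are excluded by the distinct ends of an edge and by
    \<open>inj_ends\<close>.\<close>
  have "card Z \<ge> 3"
  proof (rule ccontr)
    assume "\<not> card Z \<ge> 3"
    then have "card (Z - {i}) \<le> 1" using i(1) finZ by simp
    then consider "Z - {i} = {}" | j where "Z - {i} = {j}"
      using finZ by (metis card_le_Suc0_iff_eq finite_Diff One_nat_def is_singletonI' is_singleton_the_elem)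
    then show False
    proof cases
      case 1
      show False using uv_conn uv(2) unfolding 1 conn_empty by simp
    next
      case (2 j)
      then have j: "j \<in> Z" "j \<noteq> i" by auto
      obtain a b where ab: "ends j = {a, b}" using ends_pair[OF ZI[OF j(1)]] by blast
      have "(u, v) \<in> conn (insert j {})" using uv_conn 2 by simp
      from conn_insertD[OF this ab] uv(2) have "{u, v} = {a, b}" by (auto simp: conn_empty)
      then have "ends i = ends j" using uv ab by simp
      then show False using inj_onD[OF inj_ends] ZI i(1) j by blast
    qed
  qed
  with Z clo that show ?thesis by blast
qed

section \<open>Topology of the drawn graph\<close>

lemma compact_body: "F \<subseteq> I \<Longrightarrow> compact (body F)"
  unfolding body_def using finite_Q finite_I compact_K arc_\<gamma>
  by (intro compact_Un compact_UN compact_arc_image) (auto intro: finite_subset)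

lemma body_insert: "body (insert i F) = body F \<union> path_image (\<gamma> i)"
  by (auto simp: body_def)

lemma path_image_cases:
  assumes "i \<in> I" "x \<in> path_image (\<gamma> i)"
  obtains "x \<in> arc_interior (\<gamma> i)" | q where "q \<in> ends i" "q \<in> Q" "x \<in> K q"
proof -
  obtain a b where "a \<in> Q" "b \<in> Q" "ends i = {a, b}"
    "pathstart (\<gamma> i) \<in> K a" "pathfinish (\<gamma> i) \<in> K b"
    using ends[OF assms(1)] by blast
  with assms(2) that show ?thesis by (auto simp: arc_image_eq_interior_Un[of "\<gamma> i"])
qed

lemma interior_body:
  assumes "i \<in> I" "F \<subseteq> I" "i \<notin> F"
  shows "arc_interior (\<gamma> i) \<inter> body F = {}"
proof -
  have False if "x \<in> arc_interior (\<gamma> i)" "j \<in> F" "x \<in> path_image (\<gamma> j)" for x j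
  proof -
    have "j \<in> I" "i \<noteq> j" using that assms by auto
    from \<open>j \<in> I\<close> that(3) show False
      using interior_disjoint[OF assms(1) \<open>j \<in> I\<close> \<open>i \<noteq> j\<close>] interior_K[OF assms(1)] that(1)
      by (cases rule: path_image_cases) blast+
  qed
  then show ?thesis using interior_K[OF assms(1)] by (fastforce simp: body_def)
qed

lemma ends_in_body:
  assumes "i \<in> I" shows "pathstart (\<gamma> i) \<in> body F" "pathfinish (\<gamma> i) \<in> body F"
  using ends[OF assms] by (auto simp: body_def)

lemma path_image_body:
  assumes "i \<in> I" "F \<subseteq> I" "i \<notin> F"
  shows "path_image (\<gamma> i) \<inter> body F = {pathstart (\<gamma> i), pathfinish (\<gamma> i)}"
  using interior_body[OF assms] ends_in_body[OF assms(1)]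
  by (auto simp: arc_image_eq_interior_Un[of "\<gamma> i"])

lemma conn_path_component:
  assumes "F \<subseteq> I" "a \<in> Q" "x \<in> K a" "(a, b) \<in> conn F"
  shows "b \<in> Q \<and> (\<forall>y\<in>K b. path_component (body F) x y)"
proof -
  have Kb: "path_component (body F) y z" if "c \<in> Q" "y \<in> K c" "z \<in> K c" for c y z
  proof -
    have "path_component (K c) y z"
      using that path_connected_K[OF that(1)] by (simp add: path_connected_component)
    then show ?thesis by (rule path_component_of_subset[rotated]) (use that in \<open>auto simp: body_def\<close>)
  qed
  show ?thesis using assms(4) unfolding conn_def
  proof (induction rule: rtrancl_induct)
    case base
    then show ?case using Kb assms by blast
  next
    case (step b c)
    then obtain i where i: "i \<in> F" "ends i = {b, c}" by blast
    then have "i \<in> I" using assms(1) by blast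
    obtain p q where pq: "p \<in> path_image (\<gamma> i)" "q \<in> path_image (\<gamma> i)" "p \<in> K b" "q \<in> K c" "c \<in> Q"
      using ends[OF \<open>i \<in> I\<close>] i(2)
      by (metis doubleton_eq_iff pathstart_in_path_image pathfinish_in_path_image)
    have "path_component (path_image (\<gamma> i)) p q"
      using pq(1,2) path_connected_path_image[OF arc_imp_path[OF arc_\<gamma>[OF \<open>i \<in> I\<close>]]]
      by (simp add: path_connected_component)
    then have "path_component (body F) p q"
      by (rule path_component_of_subset[rotated]) (use i in \<open>auto simp: body_def\<close>)
    then show ?case using step.IH pq Kb path_component_trans by metis
  qed
qed

text \<open>A walk between the ends of \<open>i\<close> becomes a path in \<open>body F\<close>,
  because the fat vertices on the way are path connected; every path with distinct ends contains an
  arc.\<close>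

lemma closes_closing_arc:
  assumes "i \<in> I" "F \<subseteq> I" "i \<notin> F" "closes F i"
  obtains g where "closing_arc (body F) (\<gamma> i) g"
proof -
  obtain a b where ab: "a \<in> Q" "b \<in> Q" "a \<noteq> b" "ends i = {a, b}"
      "pathstart (\<gamma> i) \<in> K a" "pathfinish (\<gamma> i) \<in> K b"
    using ends[OF assms(1)] by blast
  then have "(b, a) \<in> conn F" using assms(4) by (auto simp: closes_def)
  then have "path_component (body F) (pathfinish (\<gamma> i)) (pathstart (\<gamma> i))"
    using conn_path_component[OF assms(2) ab(2) ab(6)] ab(5) by blast
  then obtain p where p: "path p" "path_image p \<subseteq> body F"
      "pathstart p = pathfinish (\<gamma> i)" "pathfinish p = pathstart (\<gamma> i)"
    unfolding path_component_def by blast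
  moreover have "pathstart p \<noteq> pathfinish p"
    using p arc_distinct_ends[OF arc_\<gamma>[OF assms(1)]] by simp
  ultimately obtain g where g: "arc g" "path_image g \<subseteq> path_image p"
      "pathstart g = pathstart p" "pathfinish g = pathfinish p"
    using path_contains_arc[of p] by metis
  show ?thesis
  proof (rule that, unfold_locales)
    show "closed (body F)" using compact_body[OF assms(2)] by (rule compact_imp_closed)
  qed (use g p path_image_body[OF assms(1-3)] arc_\<gamma>[OF assms(1)] in auto)
qed

text \<open>The edge joins two disjoint compact parts of the drawing, so
  \<open>connected_component_bridge\<close> applies.\<close>

lemma not_closes_connected:
  assumes i: "i \<in> I" "F \<subseteq> I" "i \<notin> F" "\<not> closes F i"
    and xy: "connected_component (- body F) x y" "x \<notin> path_image (\<gamma> i)" "y \<notin> path_image (\<gamma> i)"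
  shows "connected_component (- body (insert i F)) x y"
proof -
  obtain a b where ab: "a \<in> Q" "b \<in> Q" "a \<noteq> b" "ends i = {a, b}"
      "pathstart (\<gamma> i) \<in> K a" "pathfinish (\<gamma> i) \<in> K b"
    using ends[OF assms(1)] by blast
  \<comment> \<open>\<open>R\<close> is the abstract component of the end \<open>a\<close>. No edge
    of \<open>F\<close> leaves it, so \<open>body F\<close> is the disjoint union of
    \<open>part R\<close> and \<open>part (- R)\<close>; the end \<open>b\<close> is in the second
    part.\<close>
  define part where "part R = (\<Union>q\<in>Q \<inter> R. K q) \<union> (\<Union>j\<in>{j\<in>F. ends j \<subseteq> R}. path_image (\<gamma> j))" for R
  define R where "R = conn F `` {a}"
  have aR: "a \<in> R" by (simp add: R_def)
  have bR: "b \<notin> R" using closesI[OF ab(4)] i(4) by (auto simp: R_def)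
  have cpt: "compact (part T)" for T
    unfolding part_def using finite_Q finite_I compact_K arc_\<gamma> i(2)
    by (intro compact_Un compact_UN compact_arc_image) (auto intro: finite_subset)
  have split: "ends j \<subseteq> R \<or> ends j \<subseteq> - R" if j: "j \<in> F" for j
  proof -
    obtain c d where cd: "ends j = {c, d}" using ends_pair[of j] j i(2) by blast
    have "(c, d) \<in> conn F" "(d, c) \<in> conn F"
      using conn_edge[OF j] cd by (auto simp: insert_commute)
    then show ?thesis unfolding cd R_def by (auto intro: conn_trans)
  qed
  have body: "body F = part R \<union> part (- R)"
    using split by (fastforce simp: body_def part_def)
  have part_cases: "(\<exists>q\<in>Q \<inter> T. z \<in> K q) \<or> (\<exists>j\<in>F. ends j \<subseteq> T \<and> z \<in> arc_interior (\<gamma> j))"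
    if zT: "z \<in> part T" for z T
  proof -
    consider q where "q \<in> Q \<inter> T" "z \<in> K q" | j where "j \<in> F" "ends j \<subseteq> T" "z \<in> path_image (\<gamma> j)"
      using zT unfolding part_def by blast
    then show ?thesis
    proof cases
      case (2 j)
      then have "j \<in> I" using i(2) by blast
      from this 2(3) show ?thesis
        by (cases rule: path_image_cases) (use 2 in blast)+
    qed blast
  qed
  have disj: "part R \<inter> part (- R) = {}"
  proof -
    have False if z: "z \<in> part R" "z \<in> part (- R)" for z
    proof -
      have *: False if "q \<in> Q" "j \<in> F" "z \<in> K q" "z \<in> arc_interior (\<gamma> j)" for q j
        using interior_K[of j q] that i(2) by blast
      have **: False if "q \<in> Q" "q \<in> R" "r \<in> Q" "r \<notin> R" "z \<in> K q" "z \<in> K r" for q r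
        using disjoint_K[of q r] that by blast
      have ***: False if "j \<in> F" "k \<in> F" "ends j \<subseteq> R" "ends k \<subseteq> - R"
          "z \<in> arc_interior (\<gamma> j)" "z \<in> arc_interior (\<gamma> k)" for j k
      proof -
        have "ends j \<noteq> {}" using ends_pair[of j] that(1) i(2) by blast
        then have "j \<noteq> k" using that by blast
        then show False using interior_disjoint[of j k] that i(2) by blast
      qed
      from part_cases[OF z(1)] part_cases[OF z(2)] * ** *** show False by blast
    qed
    then show ?thesis by blast
  qed
  have s: "pathstart (\<gamma> i) \<in> part R" using ab aR by (auto simp: part_def)
  have f: "pathfinish (\<gamma> i) \<in> part (- R)" using ab bR by (auto simp: part_def)
  have "path_image (\<gamma> i) \<inter> part R = {pathstart (\<gamma> i)}" "path_image (\<gamma> i) \<inter> part (- R) = {pathfinish (\<gamma> i)}"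
    using path_image_body[OF i(1-3)] s f disj unfolding body by blast+
  with cpt disj arc_\<gamma>[OF i(1)] xy show ?thesis
    unfolding body_insert unfolding body by (intro connected_component_bridge) auto
qed

text \<open>One continuum is added at a time. It is disjoint from the earlier ones, and the empty
  intersection is connected, as Janiszewski's theorem asks.\<close>

lemma connected_compl_Union:
  assumes "finite A" "A \<subseteq> Q" shows "connected (- (\<Union>q\<in>A. K q))"
  using assms
proof (induction A rule: finite_induct)
  case (insert q A)
  have "K q \<inter> (\<Union>r\<in>A. K r) = {}" using disjoint_K[of q] insert by blast
  then have "connected (- (K q \<union> (\<Union>r\<in>A. K r)))"
    using insert compact_K connected_compl_K
    by (intro Janiszewski_connected) (auto intro!: compact_imp_closed compact_UN)
  then show ?case by simp
qed auto

text \<open>Drawing the forest edge by edge, no edge closes a cycle, hence none separates points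
  that were not separated before.\<close>

lemma connected_compl_acyclic:
  assumes "B \<subseteq> I" "acyclic_edges B" shows "connected (- body B)"
proof -
  have "finite B" using assms(1) finite_I by (rule finite_subset)
  then show ?thesis using assms
  proof (induction B rule: finite_induct)
    case empty
    then show ?case using connected_compl_Union[OF finite_Q] by (simp add: body_def)
  next
    case (insert i B)
    have "acyclic_edges B"
      using insert.prems(2) closes_mono[of "B - {_}" _ "insert i B - {_}"]
      unfolding acyclic_edges_def by blast
    then have con: "connected (- body B)" using insert by simp
    have "\<not> closes B i" using insert by (auto simp: acyclic_edges_def)
    then have "connected_component (- body (insert i B)) x y"
      if "x \<notin> body (insert i B)" "y \<notin> body (insert i B)" for x y
      using that con insert
      by (intro not_closes_connected) (auto simp: body_insert connected_iff_connected_component)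
    then show ?case by (auto simp: connected_iff_connected_component)
  qed
qed

section \<open>Faces and Euler's inequality\<close>

lemma face_diff_arc_nonempty:
  assumes "F \<subseteq> I" "i \<in> I" "\<psi> \<in> components (- body F)"
  shows "\<psi> - body (insert i F) \<noteq> {}"
proof
  assume "\<psi> - body (insert i F) = {}"
  moreover have "\<psi> \<inter> body F = {}" using in_components_subset[OF assms(3)] by blast
  ultimately have "\<psi> \<subseteq> path_image (\<gamma> i)" unfolding body_insert by blast
  moreover have "open \<psi>"
    using assms(3) compact_body[OF assms(1)] by (meson compact_imp_closed open_Compl open_components)
  ultimately have "\<psi> \<subseteq> interior (path_image (\<gamma> i))" by (simp add: interior_maximal)
  then show False
    using empty_interior_arc_image[OF arc_\<gamma>[OF assms(2)]] in_components_nonempty[OF assms(3)] by simp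
qed

lemma interior_in_face:
  assumes "i \<in> I" "F \<subseteq> I" "i \<notin> F"
  obtains \<phi> where "\<phi> \<in> components (- body F)" "arc_interior (\<gamma> i) \<subseteq> \<phi>"
proof -
  have "arc_interior (\<gamma> i) \<subseteq> - body F" using interior_body[OF assms] by blast
  moreover have "connected (arc_interior (\<gamma> i))" "arc_interior (\<gamma> i) \<noteq> {}"
    using arc_\<gamma>[OF assms(1)] by (simp_all add: connected_arc_interior arc_interior_nonempty)
  ultimately show ?thesis
    using exists_component_superset[of "arc_interior (\<gamma> i)" "- body F"] that by blast
qed

text \<open>One half of Euler's formula, by induction on the edges: an edge that closes a cycle
  creates a face, any other edge lowers the number of graph components and keeps the faces apart. A
  finite set of faces is exhibited instead of counting all of them, so finiteness of the set of all
  faces need not be known.\<close>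

lemma Euler_lower_bound:
  assumes "F \<subseteq> I"
  shows "\<exists>\<Phi>. finite \<Phi> \<and> \<Phi> \<subseteq> components (- body F) \<and>
    card F + card ((\<lambda>a. conn F `` {a}) ` Q) + 1 \<le> card \<Phi> + card Q"
proof -
  have "finite F" using assms finite_I by (rule finite_subset)
  then show ?thesis using assms
  proof (induction F rule: finite_induct)
    case empty
    have "- body {} \<noteq> {}"
    proof
      assume "- body {} = {}"
      then have "body {} = UNIV" by blast
      then have "compact (UNIV :: complex set)" using compact_body[of "{}"] by simp
      then show False using not_compact_UNIV by blast
    qed
    then obtain \<phi> where "\<phi> \<in> components (- body {})"
      using components_eq_empty by (metis ex_in_conv)
    moreover have "card ((\<lambda>a. conn {} `` {a}) ` Q) \<le> card Q" using finite_Q by (rule card_image_le)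
    ultimately show ?case by (intro exI[of _ "{\<phi>}"]) auto
  next
    case (insert i F)
    then have i: "i \<in> I" "F \<subseteq> I" "i \<notin> F" by auto
    obtain \<Phi> where \<Phi>: "finite \<Phi>" "\<Phi> \<subseteq> components (- body F)"
      "card F + card ((\<lambda>a. conn F `` {a}) ` Q) + 1 \<le> card \<Phi> + card Q"
      using insert by auto
    have sub: "body F \<subseteq> body (insert i F)" by (auto simp: body_insert)
    have "\<forall>\<psi>\<in>components (- body F). \<exists>y. y \<in> \<psi> - body (insert i F)"
      using face_diff_arc_nonempty[OF i(2,1)] by blast
    then obtain x where x: "\<And>\<psi>. \<psi> \<in> components (- body F) \<Longrightarrow> x \<psi> \<in> \<psi> - body (insert i F)"
      by metis
    define T where "T = body (insert i F)"
    show ?case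
    proof (cases "closes F i")
      case False
      define \<Psi> where "\<Psi> = (\<lambda>\<psi>. connected_component_set (- T) (x \<psi>)) ` \<Phi>"
      have \<Psi>: "\<Psi> \<subseteq> components (- T)" "card \<Psi> = card \<Phi>" "finite \<Psi>"
        using \<Phi>(1) refine_components[OF \<Phi>(2) sub, of x] x \<Phi>(2)
        unfolding \<Psi>_def T_def by (auto simp: card_image subset_iff)
      obtain a b where ab: "a \<in> Q" "b \<in> Q" "ends i = {a, b}" using ends[OF i(1)] by blast
      have "card ((\<lambda>a. conn (insert i F) `` {a}) ` Q) < card ((\<lambda>a. conn F `` {a}) ` Q)"
      proof (rule card_classes_less[OF finite_Q ab(1,2) equiv_conn equiv_conn])
        show "(a, b) \<in> conn (insert i F)" using conn_edge[OF _ ab(3)] by simp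
        show "(a, b) \<notin> conn F" using closesI[OF ab(3)] False by blast
      qed (rule conn_mono, blast)
      then have "card (insert i F) + card ((\<lambda>a. conn (insert i F) `` {a}) ` Q) + 1 \<le> card \<Psi> + card Q"
        using \<Phi>(3) \<Psi>(2) insert.hyps by simp
      then show ?thesis using \<Psi> unfolding T_def by blast
    next
      case True
      obtain g where "closing_arc (body F) (\<gamma> i) g" using closes_closing_arc[OF i True] .
      then interpret closing_arc "body F" "\<gamma> i" g .
      obtain \<phi> where \<phi>: "\<phi> \<in> components (- body F)" "arc_interior (\<gamma> i) \<subseteq> \<phi>"
        using interior_in_face[OF i] .
      have "open \<phi>"
        using \<phi>(1) compact_body[OF i(2)] by (meson compact_imp_closed open_Compl open_components)
      moreover obtain p where p: "p \<in> arc_interior (\<gamma> i)"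
        using arc_interior_nonempty[OF arc_\<gamma>[OF i(1)]] by blast
      moreover have "p \<in> path_image (\<gamma> i)" using p by (simp add: arc_interior_def)
      \<comment> \<open>The face \<open>\<phi>\<close> is an open neighbourhood of a point of the
        new edge and so reaches both sides of \<open>J\<close>.\<close>
      ultimately obtain y z where y: "y \<in> \<phi>" "y \<in> inside J" and z: "z \<in> \<phi>" "z \<in> outside J"
        using both_sides[of p \<phi>] \<phi>(2) by blast
      have JT: "J \<subseteq> T" using gS by (auto simp: J_def T_def body_insert)
      have "path_image (\<gamma> i) \<subseteq> J" by (auto simp: J_def)
      then have yz: "y \<notin> T" "z \<notin> T"
        using y z in_components_subset[OF \<phi>(1)] inside_no_overlap[of J] outside_no_overlap[of J]
        unfolding T_def body_insert by blast+
      \<comment> \<open>The face being split may be missing from \<open>\<Phi>\<close>, so it is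
        inserted. Its representative becomes \<open>y\<close>, and the component of \<open>z\<close>
        will be the additional face.\<close>
      define \<Phi>' where "\<Phi>' = insert \<phi> \<Phi>"
      define x' where "x' = x(\<phi> := y)"
      define f where "f \<psi> = connected_component_set (- T) (x' \<psi>)" for \<psi>
      have \<Phi>': "\<Phi>' \<subseteq> components (- body F)" using \<phi>(1) \<Phi>(2) by (auto simp: \<Phi>'_def)
      have x': "x' \<psi> \<in> \<psi> - T" if "\<psi> \<in> \<Phi>'" for \<psi>
        using x[of \<psi>] \<Phi>' that y yz by (auto simp: x'_def T_def)
      have f: "f ` \<Phi>' \<subseteq> components (- T)" "inj_on f \<Phi>'"
        using refine_components[OF \<Phi>' sub, of x'] x' unfolding f_def T_def by auto
      define c where "c = connected_component_set (- T) z"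
      have zc: "z \<in> c" "c \<in> components (- T)" using yz by (auto simp: c_def intro: componentsI)
      \<comment> \<open>If \<open>z\<close> could be reached off \<open>T\<close> from the
        representative of \<open>\<psi>\<close>, then \<open>\<psi>\<close> would be
        \<open>\<phi>\<close>, with representative \<open>y\<close>; but \<open>J\<close>, a part of
        \<open>T\<close>, separates \<open>y\<close> from \<open>z\<close>.\<close>
      have "c \<noteq> f \<psi>" if \<psi>: "\<psi> \<in> \<Phi>'" for \<psi>
      proof
        assume "c = f \<psi>"
        then have zx: "connected_component (- T) (x' \<psi>) z" using zc by (auto simp: f_def)
        then have "connected_component (- body F) (x' \<psi>) z"
          by (rule connected_component_of_subset) (use sub in \<open>auto simp: T_def\<close>)
        then have "z \<in> \<psi>"
          using components_eq_connected_component_set[of \<psi> "- body F" "x' \<psi>"] \<psi> \<Phi>' x'[OF \<psi>] by blast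
        moreover have "\<psi> \<in> components (- body F)" using \<psi> \<Phi>' by blast
        ultimately have "\<psi> = \<phi>" using components_nonoverlap[OF \<phi>(1)] z(1) by blast
        then have "connected_component (- T) y z" using zx by (simp add: x'_def)
        then have "connected_component (- J) y z"
          by (rule connected_component_of_subset) (use JT in auto)
        then obtain C where C: "connected C" "C \<subseteq> - J" "y \<in> C" "z \<in> C"
          by (auto simp: connected_component_def)
        then show False
          using connectedD[OF C(1), of "inside J" "outside J"] jordan y z by blast
      qed
      then have "card (insert c (f ` \<Phi>')) = Suc (card \<Phi>')"
        using \<Phi>(1) card_image[OF f(2)] by (subst card_insert_disjoint) (auto simp: \<Phi>'_def)
      moreover have "card \<Phi>' \<ge> card \<Phi>" using \<Phi>(1) by (auto simp: \<Phi>'_def intro: card_mono)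
      ultimately show ?thesis
        using \<Phi> f(1) zc(2) i insert.hyps conn_insert_closes[OF True i(1)]
        by (intro exI[of _ "insert c (f ` \<Phi>')"]) (auto simp: \<Phi>'_def T_def)
    qed
  qed
qed

text \<open>Every face bordering the edge lies in the single face \<open>\<phi>0\<close> that
  contained the edge before it was drawn, and on one side of \<open>J\<close>. By
  \<open>same_side\<close> two such faces on the same side coincide, so recording the side is
  injective.\<close>

lemma edge_in_two_faces:
  assumes i: "i \<in> I" "closes (I - {i}) i"
  defines "A \<equiv> {\<phi> \<in> components (- body I). closure \<phi> \<inter> arc_interior (\<gamma> i) \<noteq> {}}"
  shows "finite A \<and> card A \<le> 2"
proof -
  define F where "F = I - {i}"
  have F: "F \<subseteq> I" "i \<notin> F" and ins: "insert i F = I" using i by (auto simp: F_def)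
  obtain g where "closing_arc (body F) (\<gamma> i) g"
    using closes_closing_arc[OF i(1) F] i(2) by (auto simp: F_def)
  then interpret closing_arc "body F" "\<gamma> i" g .
  have bI: "body I = body F \<union> path_image (\<gamma> i)" using body_insert[of i F] ins by simp
  have JI: "J \<subseteq> body I" using gS by (auto simp: J_def bI)
  obtain \<phi>0 where \<phi>0: "\<phi>0 \<in> components (- body F)" "arc_interior (\<gamma> i) \<subseteq> \<phi>0"
    using interior_in_face[OF i(1) F] .
  have op: "open \<phi>0"
    using \<phi>0(1) compact_body[OF F(1)] by (meson compact_imp_closed open_Compl open_components)
  have sub: "\<phi> \<subseteq> \<phi>0" if "\<phi> \<in> A" for \<phi>
  proof (rule components_maximal[OF \<phi>0(1)])
    show "connected \<phi>" using that by (auto simp: A_def in_components_connected)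
    show "\<phi> \<subseteq> - body F" using that in_components_subset[of \<phi> "- body I"] by (auto simp: A_def bI)
    have "\<phi>0 \<inter> closure \<phi> \<noteq> {}" using that \<phi>0(2) by (auto simp: A_def)
    then show "\<phi>0 \<inter> \<phi> \<noteq> {}" using open_Int_closure_eq_empty[OF op] by blast
  qed
  have side: "\<phi> \<subseteq> inside J \<or> \<phi> \<subseteq> outside J" if "\<phi> \<in> A" for \<phi>
  proof -
    have *: "connected \<phi>" "\<phi> \<subseteq> inside J \<union> outside J"
      using that JI in_components_subset[of \<phi> "- body I"] jordan
      by (auto simp: A_def in_components_connected)
    then show ?thesis using connectedD[OF *(1), of "inside J" "outside J"] jordan by blast
  qed
  have uniq: "\<phi> = \<psi>" if "\<phi> \<in> A" "\<psi> \<in> A" "\<phi> \<subseteq> C" "\<psi> \<subseteq> C" "connected C" "C \<subseteq> - J" for \<phi> \<psi> C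
  proof -
    have comp: "\<phi> \<in> components (- body I)" "\<psi> \<in> components (- body I)"
      using that(1,2) by (auto simp: A_def)
    obtain a b where ab: "a \<in> \<phi>" "b \<in> \<psi>"
      using in_components_nonempty[OF comp(1)] in_components_nonempty[OF comp(2)] by blast
    have "a \<in> \<phi>0" "b \<in> \<phi>0" using ab sub that(1,2) by blast+
    then have "connected_component (- body F) a b"
      using in_components_connected[OF \<phi>0(1)] in_components_subset[OF \<phi>0(1)]
      unfolding connected_component_def by blast
    then have "connected_component (- body I) a b"
      unfolding bI using that ab by (intro same_side[of C]) auto
    then show ?thesis
      using components_eq_connected_component_set[OF comp(1) ab(1)]
        components_eq_connected_component_set[OF comp(2) ab(2)] connected_component_eq by auto
  qed
  have con: "connected (inside J)" "inside J \<subseteq> - J" "connected (outside J)" "outside J \<subseteq> - J"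
    using jordan inside_no_overlap outside_no_overlap by blast+
  define s where "s \<phi> = (\<phi> \<subseteq> inside J)" for \<phi>
  have inj: "inj_on s A"
  proof (rule inj_onI)
    fix \<phi> \<psi> assume *: "\<phi> \<in> A" "\<psi> \<in> A" "s \<phi> = s \<psi>"
    then consider "\<phi> \<subseteq> inside J" "\<psi> \<subseteq> inside J" | "\<phi> \<subseteq> outside J" "\<psi> \<subseteq> outside J"
      using side unfolding s_def by blast
    then show "\<phi> = \<psi>" by cases (use uniq[OF *(1,2)] con in blast)+
  qed
  have "finite A" by (rule inj_on_finite[OF inj]) auto
  moreover have "card A \<le> card (UNIV :: bool set)" by (rule card_inj_on_le[OF inj]) auto
  ultimately show ?thesis by (simp add: card_UNIV_bool)
qed

text \<open>If the edges bordering \<open>\<phi>\<close> formed a forest, they would not separate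
  the plane and \<open>\<phi>\<close> would be the only face. So they contain a cycle, which has at
  least three edges.\<close>

lemma face_has_three_edges:
  assumes \<phi>: "\<phi> \<in> components (- body I)" and \<psi>: "\<psi> \<in> components (- body I)" "\<psi> \<noteq> \<phi>"
  shows "card {i \<in> I. closes (I - {i}) i \<and> closure \<phi> \<inter> arc_interior (\<gamma> i) \<noteq> {}} \<ge> 3"
proof -
  define B where "B = {i \<in> I. closure \<phi> \<inter> arc_interior (\<gamma> i) \<noteq> {}}"
  have BI: "B \<subseteq> I" by (auto simp: B_def)
  have closed: "closed (body I)" using compact_body[of I] by (simp add: compact_imp_closed)
  have "\<not> acyclic_edges B"
  proof
    assume "acyclic_edges B"
    then have con: "connected (- body B)" by (rule connected_compl_acyclic[OF BI])
    \<comment> \<open>A frontier point lies on a fat vertex, and \<open>body B\<close> contains all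
      of them, or inside an edge, which then borders \<open>\<phi>\<close>.\<close>
    have fr: "frontier \<phi> \<subseteq> body B"
    proof
      fix x assume x: "x \<in> frontier \<phi>"
      then have "x \<in> body I"
        using frontier_of_components_closed_complement[OF closed \<phi>] by blast
      then consider q where "q \<in> Q" "x \<in> K q" | j where "j \<in> I" "x \<in> path_image (\<gamma> j)"
        by (auto simp: body_def)
      then show "x \<in> body B"
      proof cases
        case (2 j)
        then show ?thesis
        proof (cases rule: path_image_cases)
          case 1
          then have "j \<in> B" using x 2 by (auto simp: B_def frontier_def)
          then show ?thesis using 2 by (auto simp: body_def)
        qed (auto simp: body_def)
      qed (auto simp: body_def)
    qed
    have sub: "- body I \<subseteq> - body B" using BI by (auto simp: body_def)
    \<comment> \<open>A connected set that meets \<open>\<phi>\<close> but not its frontier stays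
      inside \<open>\<phi>\<close>.\<close>
    have "- body B \<subseteq> \<phi>"
    proof (rule ccontr)
      assume "\<not> - body B \<subseteq> \<phi>"
      moreover have "- body B \<inter> \<phi> \<noteq> {}"
        using in_components_nonempty[OF \<phi>] in_components_subset[OF \<phi>] sub by blast
      ultimately have "- body B \<inter> frontier \<phi> \<noteq> {}"
        using connected_Int_frontier[OF con] by blast
      then show False using fr by blast
    qed
    then have "\<psi> \<subseteq> \<phi>" using in_components_subset[OF \<psi>(1)] sub by blast
    then show False
      using \<phi> \<psi> components_nonoverlap[OF \<phi> \<psi>(1)] in_components_nonempty[OF \<psi>(1)] by blast
  qed
  then obtain Z where Z: "Z \<subseteq> B" "card Z \<ge> 3" "\<And>i. i \<in> Z \<Longrightarrow> closes (Z - {i}) i"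
    using cycle_edges[OF BI] by blast
  have "closes (I - {i}) i" if "i \<in> Z" for i
    using closes_mono[OF Z(3)[OF that]] Z(1) BI by blast
  then have "Z \<subseteq> {i \<in> I. closes (I - {i}) i \<and> closure \<phi> \<inter> arc_interior (\<gamma> i) \<noteq> {}}"
    using Z(1) by (auto simp: B_def)
  from card_mono[OF _ this] show ?thesis using Z(2) finite_I by simp
qed

text \<open>Double counting of incidences between faces and bordering edges gives
  \<open>3 * card \<Phi> \<le> 2 * card I\<close>, to be inserted into Euler's inequality. With at
  most one face, that inequality alone suffices.\<close>

theorem card_edges_le:
  assumes "card Q \<ge> 3" shows "card I + 6 \<le> 3 * card Q"
proof -
  obtain \<Phi> where \<Phi>: "finite \<Phi>" "\<Phi> \<subseteq> components (- body I)"
      "card I + card ((\<lambda>a. conn I `` {a}) ` Q) + 1 \<le> card \<Phi> + card Q"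
    using Euler_lower_bound[of I] by auto
  have "Q \<noteq> {}" using assms by auto
  then have "card ((\<lambda>a. conn I `` {a}) ` Q) \<ge> 1"
    using finite_Q by (simp add: Suc_le_eq card_gt_0_iff)
  with \<Phi>(3) have euler: "card I + 2 \<le> card \<Phi> + card Q" by linarith
  show ?thesis
  proof (cases "card \<Phi> \<le> 1")
    case True
    then show ?thesis using euler assms by linarith
  next
    case False
    \<comment> \<open>Bridges are left out of the incidences: the bound of two faces per edge is
      available for edges on cycles, and every face still has three of these.\<close>
    define R where "R \<phi> i \<longleftrightarrow> closes (I - {i}) i \<and> closure \<phi> \<inter> arc_interior (\<gamma> i) \<noteq> {}" for \<phi> i
    have "3 * card \<Phi> = (\<Sum>\<phi>\<in>\<Phi>. 3)" by simp
    also have "\<dots> \<le> (\<Sum>\<phi>\<in>\<Phi>. card {i \<in> I. R \<phi> i})"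
    proof (rule sum_mono)
      fix \<phi> assume \<phi>: "\<phi> \<in> \<Phi>"
      have "\<exists>\<psi>\<in>\<Phi>. \<psi> \<noteq> \<phi>"
      proof (rule ccontr)
        assume "\<not> ?thesis"
        then have "\<Phi> \<subseteq> {\<phi>}" by blast
        then show False using False card_mono[of "{\<phi>}" \<Phi>] by simp
      qed
      then show "3 \<le> card {i \<in> I. R \<phi> i}"
        unfolding R_def using face_has_three_edges \<phi> \<Phi>(2) by blast
    qed
    also have "\<dots> = (\<Sum>i\<in>I. card {\<phi> \<in> \<Phi>. R \<phi> i})"
      using \<Phi>(1) finite_I by (intro sum_multicount_gen) auto
    also have "\<dots> \<le> (\<Sum>i\<in>I. 2)"
    proof (rule sum_mono)
      fix i assume i: "i \<in> I"
      show "card {\<phi> \<in> \<Phi>. R \<phi> i} \<le> 2"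
      proof (cases "closes (I - {i}) i")
        case True
        have "{\<phi> \<in> \<Phi>. R \<phi> i} \<subseteq> {\<phi> \<in> components (- body I). closure \<phi> \<inter> arc_interior (\<gamma> i) \<noteq> {}}"
          using \<Phi>(2) by (auto simp: R_def)
        then show ?thesis using edge_in_two_faces[OF i True] by (meson card_mono le_trans)
      qed (simp add: R_def)
    qed
    finally show ?thesis using euler by simp
  qed
qed

end

section \<open>Crossed edges as fat vertices\<close>

text \<open>The legs are added one at a time. A new leg stops where it first meets the spider; if this happens on
  an older leg \<open>d\<close>, the part of \<open>d\<close> beyond the meeting point is moved into the body \<open>K\<close>.\<close>

lemma spider_exists:
  fixes U :: "complex set"
  assumes "finite A" "A \<inter> U = {}" "x \<in> U" "\<And>c. c \<in> A \<Longrightarrow> path_connected (insert c U)"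
  shows "\<exists>K \<gamma>. K \<subseteq> U \<and> compact K \<and> path_connected K \<and> connected (- K) \<and> x \<in> K \<and>
    (\<forall>c\<in>A. arc (\<gamma> c) \<and> pathstart (\<gamma> c) = c \<and> pathfinish (\<gamma> c) \<in> K \<and> arc_interior (\<gamma> c) \<subseteq> U - K) \<and>
    (\<forall>c\<in>A. \<forall>d\<in>A. c \<noteq> d \<longrightarrow> arc_interior (\<gamma> c) \<inter> arc_interior (\<gamma> d) = {})"
  using assms
proof (induction A rule: finite_induct)
  case empty
  have "connected (- {x})" using connected_punctured_universe[of x] by simp
  then show ?case using empty by (intro exI[of _ "{x}"]) auto
next
  case (insert c A)
  then obtain K \<gamma> where K: "K \<subseteq> U" "compact K" "path_connected K" "connected (- K)" "x \<in> K"
    and \<gamma>: "\<And>d. d \<in> A \<Longrightarrow> arc (\<gamma> d) \<and> pathstart (\<gamma> d) = d \<and> pathfinish (\<gamma> d) \<in> K \<and> arc_interior (\<gamma> d) \<subseteq> U - K"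
    and disj: "\<And>d e. d \<in> A \<Longrightarrow> e \<in> A \<Longrightarrow> d \<noteq> e \<Longrightarrow> arc_interior (\<gamma> d) \<inter> arc_interior (\<gamma> e) = {}"
    by (metis insert_disjoint(1) insert_iff)
  have c: "c \<notin> U" "x \<noteq> c" and AU: "A \<inter> U = {}" using insert.prems by auto
  define T where "T = K \<union> (\<Union>d\<in>A. path_image (\<gamma> d))"
  have "compact T" unfolding T_def using K \<gamma> insert.hyps(1)
    by (intro compact_Un compact_UN) (auto simp: compact_arc_image)
  have TU: "T \<subseteq> U \<union> A" and int_T: "\<And>d. d \<in> A \<Longrightarrow> arc_interior (\<gamma> d) \<subseteq> T"
    using K \<gamma> by (fastforce simp: T_def arc_image_eq_interior_Un)+
  obtain g where g: "arc g" "path_image g \<subseteq> insert c U" "pathstart g = c" "pathfinish g = x"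
    using insert.prems c unfolding path_connected_arcwise by (metis insertI1 insertI2)
  have inj: "inj_on g {0..1}" and cont: "continuous_on {0..1} g"
    using g by (auto simp: arc_def path_def)
  have g0: "g 0 = c" "g 1 = x" using g by (auto simp: pathstart_def pathfinish_def)
  have "compact ({0..1} \<inter> g -` T)"
    using continuous_closed_preimage[OF cont _ compact_imp_closed[OF \<open>compact T\<close>]]
    by (simp add: compact_eq_bounded_closed bounded_Int)
  moreover have "1 \<in> {0..1} \<inter> g -` T" using g0 K by (simp add: T_def)
  ultimately obtain t where t: "t \<in> {0..1}" "g t \<in> T" "\<And>s. s \<in> {0..1} \<Longrightarrow> g s \<in> T \<Longrightarrow> t \<le> s"
    using compact_attains_inf[of "{0..1} \<inter> g -` T"] by blast
  have "c \<notin> T" using TU c insert.hyps(2) by blast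
  then have "t \<noteq> 0" using t g0 by auto
  then have t0: "0 < t" "t \<le> 1" using t by auto
  define \<delta> where "\<delta> = subpath 0 t g"
  have gU: "g s \<in> U" if "0 < s" "s \<le> 1" for s
  proof -
    have "g s \<in> insert c U" using g(2) that unfolding path_image_def by (meson atLeastAtMost_iff imageI less_imp_le subsetD)
    moreover have "g s \<noteq> c" using inj g0 that by (metis atLeastAtMost_iff inj_onD less_eq_real_def order.irrefl zero_le_one order_refl)
    ultimately show ?thesis by blast
  qed
  have \<delta>: "arc \<delta>" "pathstart \<delta> = c" "pathfinish \<delta> = g t"
    using g g0 t0 by (auto simp: \<delta>_def intro!: arc_subpath_arc)
  have \<delta>_int: "arc_interior \<delta> \<subseteq> U - T"
  proof
    fix y assume "y \<in> arc_interior \<delta>"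
    then obtain s where s: "0 < s" "s < t" "y = g s"
      unfolding \<delta>_def arc_interior_subpath_0[OF g(1) t0] by auto
    then show "y \<in> U - T" using gU[of s] t(3)[of s] t0 by auto
  qed
  show ?case
  proof (cases "g t \<in> K")
    case True
    define \<gamma>' where "\<gamma>' = \<gamma>(c := \<delta>)"
    have "\<gamma>' c = \<delta>" and \<gamma>': "\<And>d. d \<in> A \<Longrightarrow> \<gamma>' d = \<gamma> d" using insert.hyps(2) by (auto simp: \<gamma>'_def)
    moreover have "arc_interior \<delta> \<inter> arc_interior (\<gamma> d) = {}" if "d \<in> A" for d
      using \<delta>_int int_T[OF that] by blast
    moreover have "arc_interior \<delta> \<subseteq> U - K" using \<delta>_int by (auto simp: T_def)
    ultimately show ?thesis using K \<gamma> disj \<delta> True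
      by (intro exI[of _ K] exI[of _ \<gamma>']) (simp add: Int_commute)
  next
    case False
    then obtain d where d: "d \<in> A" "g t \<in> path_image (\<gamma> d)" using t by (auto simp: T_def)
    note \<gamma>d = \<gamma>[OF d(1)]
    have d0: "\<gamma> d 0 = d" using \<gamma>d by (simp add: pathstart_def)
    have injd: "inj_on (\<gamma> d) {0..1}" using \<gamma>d by (auto simp: arc_def)
    have "g t \<noteq> d" using gU[OF t0] AU d(1) by auto
    then have "g t \<in> arc_interior (\<gamma> d)"
      using False d(2) \<gamma>d by (auto simp: arc_image_eq_interior_Un[of "\<gamma> d"])
    then obtain s where s: "0 < s" "s < 1" "g t = \<gamma> d s" using \<gamma>d by (auto simp: arc_interior_image)
    define tail where "tail = subpath s 1 (\<gamma> d)"
    have tail: "arc tail" "pathfinish tail = pathfinish (\<gamma> d)" "pathstart tail = g t"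
      using \<gamma>d s by (auto simp: tail_def pathfinish_def pathstart_def subpath_def intro!: arc_subpath_arc[unfolded subpath_def])
    have tail_im: "path_image tail = \<gamma> d ` {s..1}" using s by (simp add: tail_def path_image_subpath)
    have "{s..1} \<subseteq> insert 1 {0<..<1}" using s by auto
    then have "\<gamma> d ` {s..1} \<subseteq> insert (\<gamma> d 1) (\<gamma> d ` {0<..<1})" by blast
    then have tail_sub: "path_image tail \<subseteq> insert (pathfinish (\<gamma> d)) (arc_interior (\<gamma> d))"
      unfolding tail_im using \<gamma>d by (simp add: arc_interior_image pathfinish_def)
    have Kt: "K \<inter> path_image tail = {pathfinish (\<gamma> d)}"
      using tail_sub \<gamma>d pathfinish_in_path_image[of tail] tail(2) by auto
    define K' where "K' = K \<union> path_image tail"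
    have K'U: "K' \<subseteq> U" using K tail_sub \<gamma>d unfolding K'_def by blast
    have K'T: "K' \<subseteq> T" using tail_sub d(1) int_T[OF d(1)] \<gamma>d unfolding K'_def T_def by blast
    have K': "compact K'" "path_connected K'" "connected (- K')"
    proof -
      show "compact K'" using K tail by (simp add: K'_def compact_Un compact_arc_image)
      show "path_connected K'" unfolding K'_def using K tail Kt
        by (intro path_connected_Un path_connected_path_image arc_imp_path) auto
      show "connected (- K')" unfolding K'_def using K tail Kt
        by (intro Janiszewski_connected) (auto simp: closed_arc_image connected_arc_complement)
    qed
    define \<eta> where "\<eta> = subpath 0 s (\<gamma> d)"
    have \<eta>: "arc \<eta>" "pathstart \<eta> = d" "pathfinish \<eta> = g t"
      using \<gamma>d s d0 by (auto simp: \<eta>_def intro!: arc_subpath_arc)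
    have \<eta>_im: "arc_interior \<eta> = \<gamma> d ` {0<..<s}"
      unfolding \<eta>_def using \<gamma>d s by (intro arc_interior_subpath_0) auto
    have "{0<..<s} \<subseteq> {0<..<1}" using s by auto
    then have \<eta>_sub: "arc_interior \<eta> \<subseteq> arc_interior (\<gamma> d)"
      unfolding \<eta>_im using \<gamma>d by (auto simp: arc_interior_image)
    have "\<gamma> d ` {0<..<s} \<inter> \<gamma> d ` {s..1} = \<gamma> d ` ({0<..<s} \<inter> {s..1})"
      using s by (intro inj_on_image_Int[OF injd, symmetric]) auto
    also have "{0<..<s} \<inter> {s..1} = {}" by auto
    finally have "arc_interior \<eta> \<inter> path_image tail = {}" by (simp add: \<eta>_im tail_im)
    then have \<eta>_int: "arc_interior \<eta> \<subseteq> U - K'" using \<eta>_sub \<gamma>d unfolding K'_def by blast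
    define \<gamma>' where "\<gamma>' = \<gamma>(c := \<delta>, d := \<eta>)"
    have dc: "d \<noteq> c" using d(1) insert.hyps(2) by blast
    have \<gamma>': "\<gamma>' c = \<delta>" "\<gamma>' d = \<eta>" "\<And>e. e \<in> A \<Longrightarrow> e \<noteq> d \<Longrightarrow> \<gamma>' e = \<gamma> e"
      using dc insert.hyps(2) by (auto simp: \<gamma>'_def)
    have sub: "arc_interior (\<gamma>' e) \<subseteq> arc_interior (\<gamma> e)" if "e \<in> A" for e
      using \<gamma>'(2) \<gamma>'(3)[OF that] \<eta>_sub by (cases "e = d") auto
    have gtK': "g t \<in> K'" using pathstart_in_path_image[of tail] tail(3) by (auto simp: K'_def)
    have legs: "arc (\<gamma>' e) \<and> pathstart (\<gamma>' e) = e \<and> pathfinish (\<gamma>' e) \<in> K' \<and> arc_interior (\<gamma>' e) \<subseteq> U - K'"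
      if e: "e \<in> insert c A" for e
    proof -
      consider "e = c" | "e = d" | "e \<in> A" "e \<noteq> d" using e by blast
      then show ?thesis
      proof cases
        case 1
        then show ?thesis using \<delta> \<gamma>' \<delta>_int K'T gtK' by auto
      next
        case 2
        then show ?thesis using \<eta> \<gamma>' \<eta>_int gtK' by auto
      next
        case 3
        have "arc_interior (\<gamma> e) \<inter> path_image tail = {}"
          using tail_sub disj[OF 3(1) d(1) 3(2)] \<gamma>[OF 3(1)] \<gamma>d by blast
        then show ?thesis using \<gamma>[OF 3(1)] \<gamma>'(3)[OF 3] unfolding K'_def by auto
      qed
    qed
    have "arc_interior (\<gamma>' e) \<inter> arc_interior (\<gamma>' f) = {}"
      if e: "e \<in> insert c A" "f \<in> insert c A" "e \<noteq> f" for e f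
    proof -
      have c': "arc_interior (\<gamma>' c) \<inter> arc_interior (\<gamma>' h) = {}" if "h \<in> A" for h
        using \<gamma>'(1) sub[OF that] int_T[OF that] \<delta>_int by blast
      consider "e = c" "f \<in> A" | "f = c" "e \<in> A" | "e \<in> A" "f \<in> A" using e by blast
      then show ?thesis
      proof cases
        case 3
        then show ?thesis using sub disj[OF 3 e(3)] by blast
      qed (use c' in blast)+
    qed
    then show ?thesis using K'U K' K(5) legs
      by (intro exI[of _ K'] exI[of _ \<gamma>']) (auto simp: K'_def)
  qed
qed

lemma planar_bound_with_regions:
  fixes V :: "'a set" and F :: "'a set set" and \<U> :: "complex set set"
  assumes V: "finite V" "card V \<ge> 3" "inj_on pos V"
    and F: "finite F" "\<And>e. e \<in> F \<Longrightarrow> e \<subseteq> V \<and> card e = 2"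
      "\<And>e. e \<in> F \<Longrightarrow> arc (crv e) \<and> {pathstart (crv e), pathfinish (crv e)} = pos ` e"
      "\<And>e. e \<in> F \<Longrightarrow> arc_interior (crv e) \<inter> pos ` V = {}"
      "\<And>e f. e \<in> F \<Longrightarrow> f \<in> F \<Longrightarrow> e \<noteq> f \<Longrightarrow> arc_interior (crv e) \<inter> arc_interior (crv f) = {}"
    and U: "finite \<U>" "\<And>U. U \<in> \<U> \<Longrightarrow> U \<noteq> {}" "\<And>U. U \<in> \<U> \<Longrightarrow> A U \<subseteq> V"
      "\<And>U v. U \<in> \<U> \<Longrightarrow> v \<in> A U \<Longrightarrow> path_connected (insert (pos v) U)"
      "\<And>U. U \<in> \<U> \<Longrightarrow> U \<inter> pos ` V = {}"
      "\<And>U U'. U \<in> \<U> \<Longrightarrow> U' \<in> \<U> \<Longrightarrow> U \<noteq> U' \<Longrightarrow> U \<inter> U' = {}"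
      "\<And>U e. U \<in> \<U> \<Longrightarrow> e \<in> F \<Longrightarrow> arc_interior (crv e) \<inter> U = {}"
  shows "card F + (\<Sum>U\<in>\<U>. card (A U)) + 6 \<le> 3 * (card V + card \<U>)"
proof -
  have "\<forall>U\<in>\<U>. \<exists>K \<gamma>. K \<subseteq> U \<and> compact K \<and> path_connected K \<and> connected (- K) \<and>
    (\<forall>c\<in>pos ` A U. arc (\<gamma> c) \<and> pathstart (\<gamma> c) = c \<and> pathfinish (\<gamma> c) \<in> K \<and> arc_interior (\<gamma> c) \<subseteq> U - K) \<and>
    (\<forall>c\<in>pos ` A U. \<forall>d\<in>pos ` A U. c \<noteq> d \<longrightarrow> arc_interior (\<gamma> c) \<inter> arc_interior (\<gamma> d) = {})"
  proof
    fix U assume "U \<in> \<U>"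
    obtain x where "x \<in> U" using U(2)[OF \<open>U \<in> \<U>\<close>] by blast
    moreover have "finite (pos ` A U)" using U(3)[OF \<open>U \<in> \<U>\<close>] V(1) finite_subset by blast
    moreover have "pos ` A U \<inter> U = {}" using U(3,5)[OF \<open>U \<in> \<U>\<close>] by blast
    moreover have "\<And>c. c \<in> pos ` A U \<Longrightarrow> path_connected (insert c U)"
      using U(4)[OF \<open>U \<in> \<U>\<close>] by blast
    ultimately show "\<exists>K \<gamma>. K \<subseteq> U \<and> compact K \<and> path_connected K \<and> connected (- K) \<and>
      (\<forall>c\<in>pos ` A U. arc (\<gamma> c) \<and> pathstart (\<gamma> c) = c \<and> pathfinish (\<gamma> c) \<in> K \<and> arc_interior (\<gamma> c) \<subseteq> U - K) \<and>
      (\<forall>c\<in>pos ` A U. \<forall>d\<in>pos ` A U. c \<noteq> d \<longrightarrow> arc_interior (\<gamma> c) \<inter> arc_interior (\<gamma> d) = {})"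
      using spider_exists[of "pos ` A U" U x] by blast
  qed
  then obtain K \<gamma> where
    K: "\<And>U. U \<in> \<U> \<Longrightarrow> K U \<subseteq> U \<and> compact (K U) \<and> path_connected (K U) \<and> connected (- K U)" and
    leg: "\<And>U c. U \<in> \<U> \<Longrightarrow> c \<in> pos ` A U \<Longrightarrow>
      arc (\<gamma> U c) \<and> pathstart (\<gamma> U c) = c \<and> pathfinish (\<gamma> U c) \<in> K U \<and> arc_interior (\<gamma> U c) \<subseteq> U - K U" and
    legs: "\<And>U c d. U \<in> \<U> \<Longrightarrow> c \<in> pos ` A U \<Longrightarrow> d \<in> pos ` A U \<Longrightarrow> c \<noteq> d \<Longrightarrow>
      arc_interior (\<gamma> U c) \<inter> arc_interior (\<gamma> U d) = {}"
    by metis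
  define Q where "Q = Inl ` V \<union> Inr ` \<U>"
  define KK where "KK = case_sum (\<lambda>v. {pos v}) K"
  define I where "I = Inl ` F \<union> Inr ` (SIGMA U:\<U>. A U)"
  define ends :: "'a set + complex set \<times> 'a \<Rightarrow> ('a + complex set) set"
    where "ends = case_sum (\<lambda>e. Inl ` e) (\<lambda>(U, v). {Inl v, Inr U})"
  define \<gamma>\<gamma> where "\<gamma>\<gamma> = case_sum crv (\<lambda>(U, v). \<gamma> U (pos v))"
  have finA: "finite (A U)" if "U \<in> \<U>" for U using U(3)[OF that] V(1) finite_subset by blast
  have legU: "arc_interior (\<gamma> U (pos v)) \<subseteq> U - K U" if "U \<in> \<U>" "v \<in> A U" for U v
    using leg that by blast
  interpret fat_plane_graph Q KK I ends \<gamma>\<gamma>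
  proof
    show "finite Q" using V(1) U(1) by (simp add: Q_def)
    show "finite I" using F(1) U(1) finA by (auto simp: I_def)
  next
    fix q assume "q \<in> Q"
    then show "compact (KK q)" "path_connected (KK q)" "connected (- KK q)"
      using K by (auto simp: Q_def KK_def connected_punctured_universe)
  next
    fix q r assume qr: "q \<in> Q" "r \<in> Q" "q \<noteq> r"
    have *: "pos v \<notin> K U" if "v \<in> V" "U \<in> \<U>" for v U using K[OF that(2)] U(5)[OF that(2)] that(1) by blast
    have **: "K U \<inter> K U' = {}" if "U \<in> \<U>" "U' \<in> \<U>" "U \<noteq> U'" for U U'
      using K[OF that(1)] K[OF that(2)] U(6)[OF that] by blast
    have ***: "pos v \<noteq> pos w" if "v \<in> V" "w \<in> V" "v \<noteq> w" for v w
      using inj_onD[OF V(3)] that by blast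
    show "KK q \<inter> KK r = {}"
    proof (cases q)
      case q: (Inl v)
      show ?thesis
        by (cases r) (use q qr * *** in \<open>auto simp: Q_def KK_def\<close>)
    next
      case q: (Inr U)
      show ?thesis
      proof (cases r)
        case (Inr W)
        with q qr **[of U W] show ?thesis by (auto simp: Q_def KK_def)
      qed (use q qr * in \<open>auto simp: Q_def KK_def\<close>)
    qed
  next
    fix i assume "i \<in> I"
    then consider e where "i = Inl e" "e \<in> F" | U v where "i = Inr (U, v)" "U \<in> \<U>" "v \<in> A U"
      by (auto simp: I_def)
    note cases = this
    from cases show "arc (\<gamma>\<gamma> i)" by cases (use F(3) leg in \<open>auto simp: \<gamma>\<gamma>_def\<close>)
    from cases show "\<exists>a\<in>Q. \<exists>b\<in>Q. a \<noteq> b \<and> ends i = {a, b} \<and>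
        pathstart (\<gamma>\<gamma> i) \<in> KK a \<and> pathfinish (\<gamma>\<gamma> i) \<in> KK b"
    proof cases
      case (1 e)
      obtain a b where ab: "e = {a, b}" "a \<noteq> b" using F(2)[OF 1(2)] by (auto simp: card_2_iff)
      then have V: "a \<in> V" "b \<in> V" using F(2)[OF 1(2)] by auto
      have "{pathstart (crv e), pathfinish (crv e)} = {pos a, pos b}" using F(3)[OF 1(2)] ab by simp
      then consider "pathstart (crv e) = pos a" "pathfinish (crv e) = pos b"
        | "pathstart (crv e) = pos b" "pathfinish (crv e) = pos a" by (auto simp: doubleton_eq_iff)
      then show ?thesis
      proof cases
        case A: 1
        show ?thesis by (rule bexI[of _ "Inl a"], rule bexI[of _ "Inl b"])
          (use A ab V 1 in \<open>auto simp: Q_def KK_def ends_def \<gamma>\<gamma>_def\<close>)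
      next
        case A: 2
        show ?thesis by (rule bexI[of _ "Inl b"], rule bexI[of _ "Inl a"])
          (use A ab V 1 in \<open>auto simp: Q_def KK_def ends_def \<gamma>\<gamma>_def\<close>)
      qed
    next
      case (2 U v)
      show ?thesis by (rule bexI[of _ "Inl v"], rule bexI[of _ "Inr U"])
        (use 2 leg[of U "pos v"] U(3)[of U] in \<open>auto simp: Q_def KK_def ends_def \<gamma>\<gamma>_def\<close>)
    qed
    fix q assume "q \<in> Q"
    then consider w where "q = Inl w" "w \<in> V" | W where "q = Inr W" "W \<in> \<U>" by (auto simp: Q_def)
    note casesq = this
    from cases show "arc_interior (\<gamma>\<gamma> i) \<inter> KK q = {}"
    proof cases
      case (1 e)
      from casesq show ?thesis
      proof cases
        case (1 w)
        then show ?thesis using \<open>i = _\<close> F(4)[OF \<open>e \<in> F\<close>] by (auto simp: \<gamma>\<gamma>_def KK_def)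
      next
        case (2 W)
        have "arc_interior (crv e) \<inter> K W = {}" using U(7)[OF 2(2) \<open>e \<in> F\<close>] K[OF 2(2)] by blast
        then show ?thesis using \<open>i = _\<close> 2 by (simp add: \<gamma>\<gamma>_def KK_def)
      qed
    next
      case (2 U v)
      from casesq show ?thesis
      proof cases
        case (1 w)
        then show ?thesis using 2 legU[OF 2(2,3)] U(5)[OF 2(2)] by (auto simp: \<gamma>\<gamma>_def KK_def)
      next
        case (2 W)
        then show ?thesis using legU[OF \<open>U \<in> \<U>\<close> \<open>v \<in> A U\<close>] U(6)[OF \<open>U \<in> \<U>\<close> 2(2)] K[OF 2(2)] \<open>i = _\<close>
          by (cases "U = W") (auto simp: \<gamma>\<gamma>_def KK_def)
      qed
    qed
  next
    show "inj_on ends I"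
    proof (rule inj_onI)
      fix i j assume "i \<in> I" "j \<in> I" "ends i = ends j"
      then show "i = j" unfolding I_def ends_def
        by (auto simp: doubleton_eq_iff inj_image_eq_iff)
    qed
  next
    fix i j assume ij: "i \<in> I" "j \<in> I" "i \<noteq> j"
    have EL: "arc_interior (crv e) \<inter> arc_interior (\<gamma> U (pos v)) = {}"
      if "e \<in> F" "U \<in> \<U>" "v \<in> A U" for e U v
      using legU[OF that(2,3)] U(7)[OF that(2,1)] by blast
    have LL: "arc_interior (\<gamma> U (pos v)) \<inter> arc_interior (\<gamma> W (pos w)) = {}"
      if "U \<in> \<U>" "v \<in> A U" "W \<in> \<U>" "w \<in> A W" "(U, v) \<noteq> (W, w)" for U v W w
    proof (cases "U = W")
      case True
      then have "pos v \<noteq> pos w" using that U(3)[OF that(1)] V(3) by (auto dest: inj_onD)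
      then show ?thesis using True legs that by auto
    next
      case False
      then show ?thesis using legU[OF that(1,2)] legU[OF that(3,4)] U(6)[OF that(1,3)] by blast
    qed
    show "arc_interior (\<gamma>\<gamma> i) \<inter> arc_interior (\<gamma>\<gamma> j) = {}"
    proof (cases i)
      case i: (Inl e)
      show ?thesis
      proof (cases j)
        case (Inl f)
        with i ij F(5)[of e f] show ?thesis by (auto simp: I_def \<gamma>\<gamma>_def)
      next
        case (Inr p)
        with i ij EL[of e "fst p" "snd p"] show ?thesis by (auto simp: I_def \<gamma>\<gamma>_def)
      qed
    next
      case i: (Inr p)
      show ?thesis
      proof (cases j)
        case (Inl f)
        with i ij EL[of f "fst p" "snd p"] show ?thesis by (auto simp: I_def \<gamma>\<gamma>_def)
      next
        case (Inr r)
        with i ij LL[of "fst p" "snd p" "fst r" "snd r"] show ?thesis by (auto simp: I_def \<gamma>\<gamma>_def)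
      qed
    qed
  qed
  have cQ: "card Q = card V + card \<U>"
    unfolding Q_def using V(1) U(1) by (subst card_Un_disjoint) (auto simp: card_image)
  have "card I = card F + card (SIGMA U:\<U>. A U)"
    unfolding I_def using F(1) U(1) finA by (subst card_Un_disjoint) (auto simp: card_image)
  also have "card (SIGMA U:\<U>. A U) = (\<Sum>U\<in>\<U>. card (A U))"
    using U(1) finA by (intro card_SigmaI) auto
  finally show ?thesis using card_edges_le cQ V(2) by simp
qed

lemma simple_graph_finite_edges:
  assumes "simple_graph V E" shows "finite E"
proof -
  have "E \<subseteq> Pow V" "finite V" using assms by (auto simp: simple_graph_def)
  then show ?thesis by (metis finite_Pow_iff finite_subset)
qed

lemma simple_graph_card_edges_le:
  assumes "simple_graph V E" shows "2 * card E \<le> card V * (card V - 1)"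
proof -
  have "E \<subseteq> {A. A \<subseteq> V \<and> card A = 2}" and V: "finite V"
    using assms by (auto simp: simple_graph_def)
  then have "card E \<le> card V choose 2"
    using card_mono[of "{A. A \<subseteq> V \<and> card A = 2}" E] n_subsets[OF V, of 2] by simp
  then show ?thesis by (simp add: choose_two)
qed

lemma crossed_clusters:
  fixes V :: "'a set" and E :: "'a set set"
  assumes G: "simple_graph V E" "card V \<ge> 3" and D: "is_drawing V E D"
  defines "H \<equiv> {e \<in> E. uncrossed_in E D e}"
  shows "\<exists>(\<U> :: complex set set) d. finite \<U> \<and> (\<forall>U\<in>\<U>. (1::nat) \<le> d U) \<and>
    card H + sum d \<U> + 6 \<le> 3 * card V \<and>
    2 * card (E - H) \<le> (\<Sum>U\<in>\<U>. (d U + 3) * (d U + 2))"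
proof -
  obtain pos crv where D_eq: "D = (pos, crv)" by (cases D)
  have finV: "finite V" and E: "\<And>e. e \<in> E \<Longrightarrow> e \<subseteq> V \<and> card e = 2"
    using G(1) by (auto simp: simple_graph_def)
  have finE: "finite E" using G(1) by (rule simple_graph_finite_edges)
  have inj: "inj_on pos V" and arc: "\<And>e. e \<in> E \<Longrightarrow> arc (crv e)"
    and ends: "\<And>e. e \<in> E \<Longrightarrow> {pathstart (crv e), pathfinish (crv e)} = pos ` e"
    and img: "\<And>e. e \<in> E \<Longrightarrow> path_image (crv e) \<inter> pos ` V = pos ` e"
    using D unfolding is_drawing_def D_eq by auto
  define J where "J e = arc_interior (crv e)" for e
  have J_V: "J e \<inter> pos ` V = {}" if "e \<in> E" for e
    using img[OF that] ends[OF that] unfolding J_def arc_interior_def by blast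
  have J_pc: "path_connected (J e)" and J_ne: "J e \<noteq> {}" if "e \<in> E" for e
    using arc[OF that] by (simp_all add: J_def path_connected_arc_interior arc_interior_nonempty)
  have H_iff: "e \<in> H \<longleftrightarrow> e \<in> E \<and> (\<forall>f\<in>E. f \<noteq> e \<longrightarrow> J e \<inter> J f = {})" for e
    by (auto simp: H_def uncrossed_in_def D_eq J_def)
  define C where "C = E - H"
  define W where "W = (\<Union>e\<in>C. J e)"
  define comp where "comp e = path_component_set W (SOME p. p \<in> J e)" for e
  define \<U> where "\<U> = comp ` C"
  have CE: "e \<in> E" if "e \<in> C" for e using that by (simp add: C_def)
  have comp_eq: "comp e = path_component_set W p" if "e \<in> C" "p \<in> J e" for e p
  proof -
    have "(SOME p. p \<in> J e) \<in> J e" using that(2) by (rule someI)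
    then have "path_component (J e) (SOME p. p \<in> J e) p"
      using J_pc[OF CE[OF that(1)]] that(2) by (simp add: path_connected_component)
    then have "path_component W (SOME p. p \<in> J e) p"
      by (rule path_component_of_subset[rotated]) (use that in \<open>auto simp: W_def\<close>)
    then show ?thesis unfolding comp_def by (simp add: path_component_eq)
  qed
  have J_comp: "J e \<subseteq> comp e" if "e \<in> C" for e
  proof
    fix p assume "p \<in> J e"
    then show "p \<in> comp e" using comp_eq[OF that] that by (auto simp: W_def intro!: path_component_refl)
  qed
  have comp_W: "comp e \<subseteq> W" for e unfolding comp_def by (rule path_component_subset)
  have disj: "U \<inter> U' = {}" if UU: "U \<in> \<U>" "U' \<in> \<U>" "U \<noteq> U'" for U U'
  proof -
    obtain x y where U: "U = path_component_set W x" "U' = path_component_set W y"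
      using UU(1,2) unfolding \<U>_def comp_def by blast
    have "U = U'" if "z \<in> U" "z \<in> U'" for z
      using that path_component_eq[of z W x] path_component_eq[of z W y] unfolding U by simp
    then show ?thesis using UU(3) by blast
  qed
  have same_comp: "comp e = comp f" if "e \<in> C" "f \<in> C" "J e \<inter> J f \<noteq> {}" for e f
    using that comp_eq by blast
  have W_H: "J e \<inter> W = {}" if "e \<in> H" for e
  proof -
    have "J e \<inter> J f = {}" if "f \<in> C" for f
    proof -
      have "f \<in> E" "f \<noteq> e" using that \<open>e \<in> H\<close> unfolding C_def by blast+
      then show ?thesis using \<open>e \<in> H\<close> unfolding H_iff by blast
    qed
    then show ?thesis unfolding W_def by blast
  qed
  have W_V: "W \<inter> pos ` V = {}" using J_V CE by (auto simp: W_def)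
  define CU where "CU U = {e \<in> C. comp e = U}" for U
  define A where "A U = \<Union> (CU U)" for U
  have A_V: "A U \<subseteq> V" for U using E CE by (auto simp: A_def CU_def)
  have finA: "finite (A U)" for U using A_V finV by (rule finite_subset)
  have fin\<U>: "finite \<U>" using finE by (simp add: \<U>_def C_def)
  have A3: "card (A U) \<ge> 3" if U: "U \<in> \<U>" for U
  proof -
    obtain e where e: "e \<in> C" "U = comp e" using U unfolding \<U>_def by blast
    then obtain f where f: "f \<in> E" "f \<noteq> e" "J e \<inter> J f \<noteq> {}" unfolding C_def Diff_iff H_iff by blast
    then have "f \<in> C" using CE[OF e(1)] unfolding C_def Diff_iff H_iff by blast
    then have "comp f = U" using same_comp e f by metis
    then have sub: "e \<union> f \<subseteq> A U" using e \<open>f \<in> C\<close> by (auto simp: A_def CU_def)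
    have ce: "card e = 2" "card f = 2" "finite e" "finite f"
      using E CE e(1) f(1) by (auto simp: card_2_iff)
    have "\<not> f \<subseteq> e" using ce f(2) card_subset_eq[of e f] by auto
    then have "e \<subset> e \<union> f" by blast
    then have "card e < card (e \<union> f)" using ce by (intro psubset_card_mono) auto
    then show ?thesis using card_mono[OF finA sub] ce by linarith
  qed
  have CU_le: "2 * card (CU U) \<le> card (A U) * (card (A U) - 1)" for U
  proof -
    have "CU U \<subseteq> {B. B \<subseteq> A U \<and> card B = 2}" using E CE by (auto simp: CU_def A_def)
    then have "card (CU U) \<le> card {B. B \<subseteq> A U \<and> card B = 2}"
      using finA by (intro card_mono) auto
    also have "\<dots> = card (A U) choose 2" using finA by (rule n_subsets)
    finally show ?thesis by (simp add: choose_two)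
  qed
  define d where "d U = (if card (A U) = 3 then 1 else card (A U) - 3)" for U
  define \<U>3 where "\<U>3 = {U \<in> \<U>. card (A U) = 3}"
  define \<U>4 where "\<U>4 = \<U> - \<U>3"
  have "\<forall>U\<in>\<U>3. \<exists>e. e \<in> CU U" by (auto simp: \<U>3_def \<U>_def CU_def)
  then obtain rep where rep: "\<And>U. U \<in> \<U>3 \<Longrightarrow> rep U \<in> CU U" by metis
  define F where "F = H \<union> rep ` \<U>3"
  have fin3: "finite \<U>3" "finite \<U>4" using fin\<U> by (auto simp: \<U>3_def \<U>4_def)
  have repC: "rep U \<in> C" "comp (rep U) = U" if "U \<in> \<U>3" for U using rep[OF that] by (auto simp: CU_def)
  have rep_inj: "inj_on rep \<U>3" using repC(2) by (rule inj_on_inverseI)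
  have finH: "finite H" using finE by (simp add: H_def)
  have "H \<inter> rep ` \<U>3 = {}" using repC by (auto simp: C_def)
  then have cardF: "card F = card H + card \<U>3"
    unfolding F_def using finH fin3 by (simp add: card_Un_disjoint card_image[OF rep_inj])
  have FE: "F \<subseteq> E" using repC CE by (auto simp: F_def H_def)
  have "card F + (\<Sum>U\<in>\<U>4. card (A U)) + 6 \<le> 3 * (card V + card \<U>4)"
  proof (rule planar_bound_with_regions[OF finV G(2) inj])
    show "finite F" using FE finE by (rule finite_subset)
    show "arc (crv e) \<and> {pathstart (crv e), pathfinish (crv e)} = pos ` e" if "e \<in> F" for e
      using arc ends that FE by blast
    show "arc_interior (crv e) \<inter> pos ` V = {}" if "e \<in> F" for e
      using J_V that FE unfolding J_def by blast
    show "arc_interior (crv e) \<inter> arc_interior (crv f) = {}" if ef: "e \<in> F" "f \<in> F" "e \<noteq> f" for e f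
    proof (cases "e \<in> H \<or> f \<in> H")
      case True
      then show ?thesis using ef FE unfolding H_iff J_def by blast
    next
      case False
      then obtain U U' where U: "U \<in> \<U>3" "U' \<in> \<U>3" "e = rep U" "f = rep U'"
        using ef(1,2) unfolding F_def by blast
      then have "U \<noteq> U'" using ef by auto
      then have "comp e \<noteq> comp f" using U repC by simp
      then show ?thesis using same_comp[of e f] U repC(1) unfolding J_def by blast
    qed
    show "U \<inter> U' = {}" if "U \<in> \<U>4" "U' \<in> \<U>4" "U \<noteq> U'" for U U'
      using disj that by (auto simp: \<U>4_def)
    fix U assume U: "U \<in> \<U>4"
    then obtain e0 where e0: "e0 \<in> C" "U = comp e0" unfolding \<U>4_def \<U>_def by blast
    show "U \<noteq> {}" using J_comp[OF e0(1)] J_ne[OF CE[OF e0(1)]] e0(2) by blast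
    show "U \<inter> pos ` V = {}" using comp_W W_V e0(2) by blast
    show "path_connected (insert (pos v) U)" if v: "v \<in> A U" for v
    proof -
      obtain e where e: "e \<in> C" "comp e = U" "v \<in> e" using v unfolding A_def CU_def by blast
      have "pos v \<in> {pathstart (crv e), pathfinish (crv e)}" using ends[OF CE[OF e(1)]] e(3) by blast
      then have "path_connected (insert (pos v) (J e))"
        unfolding J_def using arc[OF CE[OF e(1)]] by (intro path_connected_insert_arc_interior)
      moreover have "path_connected U" unfolding e0(2) comp_def by simp
      moreover have "J e \<subseteq> U" "J e \<noteq> {}" using J_comp[OF e(1)] e(2) J_ne[OF CE[OF e(1)]] by auto
      ultimately have "path_connected (insert (pos v) (J e) \<union> U)"
        by (intro path_connected_Un) auto
      moreover have "insert (pos v) (J e) \<union> U = insert (pos v) U" using \<open>J e \<subseteq> U\<close> by blast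
      ultimately show ?thesis by simp
    qed
    show "arc_interior (crv e) \<inter> U = {}" if eF: "e \<in> F" for e
    proof (cases "e \<in> H")
      case True
      then show ?thesis using W_H comp_W e0(2) unfolding J_def by blast
    next
      case False
      then obtain U' where U': "U' \<in> \<U>3" "e = rep U'" using eF unfolding F_def by blast
      then have "J e \<subseteq> U'" using J_comp repC by metis
      moreover have "U' \<inter> U = {}" using U U'(1) by (intro disj) (auto simp: \<U>3_def \<U>4_def)
      ultimately show ?thesis unfolding J_def by blast
    qed
  qed (use E FE A_V fin3 in auto)
  moreover have "(\<Sum>U\<in>\<U>4. card (A U)) = sum d \<U>4 + 3 * card \<U>4"
  proof -
    have "(\<Sum>U\<in>\<U>4. card (A U)) = (\<Sum>U\<in>\<U>4. d U + 3)"
      using A3 by (intro sum.cong) (auto simp: \<U>4_def \<U>3_def d_def)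
    then show ?thesis by (simp add: sum.distrib)
  qed
  moreover have "sum d \<U> = card \<U>3 + sum d \<U>4"
  proof -
    have "sum d \<U> = sum d \<U>3 + sum d \<U>4"
      using sum.subset_diff[of \<U>3 \<U> d] fin\<U> by (auto simp: \<U>3_def \<U>4_def)
    then show ?thesis by (simp add: d_def \<U>3_def)
  qed
  ultimately have bound: "card H + sum d \<U> + 6 \<le> 3 * card V" using cardF by simp
  have "C = (\<Union>U\<in>\<U>. CU U)" by (auto simp: CU_def \<U>_def)
  then have "card C \<le> (\<Sum>U\<in>\<U>. card (CU U))" using card_UN_le[OF fin\<U>] by metis
  then have "2 * card C \<le> (\<Sum>U\<in>\<U>. 2 * card (CU U))" by (simp add: sum_distrib_left[symmetric])
  also have "\<dots> \<le> (\<Sum>U\<in>\<U>. (d U + 3) * (d U + 2))"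
  proof (rule sum_mono)
    fix U assume "U \<in> \<U>"
    then have "card (A U) \<le> d U + 3" "card (A U) - 1 \<le> d U + 2" using A3 by (auto simp: d_def)
    then have "card (A U) * (card (A U) - 1) \<le> (d U + 3) * (d U + 2)" by (rule mult_le_mono)
    then show "2 * card (CU U) \<le> (d U + 3) * (d U + 2)" using CU_le le_trans by blast
  qed
  finally have "2 * card (E - H) \<le> (\<Sum>U\<in>\<U>. (d U + 3) * (d U + 2))" by (simp add: C_def)
  moreover have "\<forall>U\<in>\<U>. 1 \<le> d U" using A3 by (fastforce simp: d_def)
  ultimately show ?thesis using fin\<U> bound by blast
qed

lemma sum_power2_le:
  fixes d :: "'b \<Rightarrow> nat"
  assumes "finite A" shows "(\<Sum>x\<in>A. d x ^ 2) \<le> (sum d A) ^ 2"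
  using assms
proof (induction A rule: finite_induct)
  case (insert x A)
  then show ?case by (simp add: power2_sum)
qed simp

lemma card_uncrossed_le:
  fixes V :: "'a set" and E :: "'a set set"
  assumes G: "simple_graph V E" "card V \<ge> 3" and D: "is_drawing V E D"
  defines "n \<equiv> real (card V)" and "m \<equiv> real (card E)"
  shows "real (card {e \<in> E. uncrossed_in E D e}) \<le> 3 * n - 6 - sqrt (2 * m) + sqrt (6 * (n - 2))"
proof -
  define H where "H = {e \<in> E. uncrossed_in E D e}"
  have finE: "finite E" using G(1) by (rule simple_graph_finite_edges)
  obtain \<U> :: "complex set set" and d where d: "finite \<U>" "\<And>U. U \<in> \<U> \<Longrightarrow> (1::nat) \<le> d U"
      "card H + sum d \<U> + 6 \<le> 3 * card V" "2 * card (E - H) \<le> (\<Sum>U\<in>\<U>. (d U + 3) * (d U + 2))"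
    using crossed_clusters[OF G D] unfolding H_def[symmetric] by blast
  have n3: "n \<ge> 3" using G(2) by (simp add: n_def)
  define h where "h = real (card H)"
  define t where "t = 3 * n - 6 - h"
  define s where "s = sqrt (6 * (n - 2))"
  have s2: "s ^ 2 = 6 * (n - 2)" and s0: "s \<ge> 0" using n3 by (auto simp: s_def)
  define T where "T = sum d \<U>"
  have cU: "card \<U> \<le> T" using sum_mono[of \<U> "\<lambda>_. 1" d] d(2) by (simp add: T_def)
  have "(\<Sum>U\<in>\<U>. (d U + 3) * (d U + 2)) = (\<Sum>U\<in>\<U>. d U ^ 2) + 5 * T + 6 * card \<U>"
    by (simp add: T_def algebra_simps sum.distrib sum_distrib_left[symmetric] sum_distrib_right[symmetric] power2_eq_square)
  also have "\<dots> \<le> T ^ 2 + 11 * T" using sum_power2_le[OF d(1), of d] cU by (simp add: T_def)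
  finally have "2 * card (E - H) \<le> T ^ 2 + 11 * T" using d(4) by linarith
  then have "real (2 * card (E - H)) \<le> real (T ^ 2 + 11 * T)" by (rule of_nat_mono)
  moreover have "card E = card H + card (E - H)"
    using finE card_Diff_subset[of H E] card_mono[of E H] by (auto simp: H_def finite_subset)
  then have "m = h + card (E - H)" by (simp add: m_def h_def)
  ultimately have mT: "2 * (m - h) \<le> real T ^ 2 + 11 * real T" by simp
  have "real (card H + T + 6) \<le> real (3 * card V)" using d(3) unfolding T_def by (rule of_nat_mono)
  then have Tt: "real T \<le> t" by (simp add: t_def h_def n_def)
  then have "real T ^ 2 \<le> t ^ 2" by (intro power_mono) auto
  moreover have "h = 3 * n - 6 - t" by (simp add: t_def)
  ultimately have mt: "2 * m \<le> 2 * (3 * n - 6) + t ^ 2 + 9 * t" using mT Tt by argo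
  have t0: "t \<ge> 0" using Tt by simp
  have m_le: "2 * m \<le> n * (n - 1)"
  proof -
    have "real (2 * card E) \<le> real (card V * (card V - 1))"
      using simple_graph_card_edges_le[OF G(1)] by (rule of_nat_mono)
    then show ?thesis using G(2) by (simp add: m_def n_def of_nat_diff)
  qed
  have "2 * m \<le> (t + s) ^ 2"
  proof (cases "2 * m \<le> s ^ 2")
    case True
    also have "s ^ 2 \<le> (t + s) ^ 2" using t0 s0 by (intro power_mono) auto
    finally show ?thesis .
  next
    case False
    then have t_pos: "t > 0" using mt s2 t0 by (cases "t = 0") auto
    have tk: "t = real_of_int (3 * int (card V) - 6 - int (card H))" by (simp add: t_def n_def h_def)
    have t1: "t \<ge> 1" using t_pos unfolding tk of_int_0_less_iff of_int_1_le_iff by simp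
    have sq: "(t + s) ^ 2 = t ^ 2 + 2 * s * t + 6 * (n - 2)"
      using s2 by (simp add: power2_sum algebra_simps)
    show ?thesis
    proof (cases "card V \<ge> 6")
      case True
      then have "n \<ge> 6" by (simp add: n_def)
      then have "(9 / 2) ^ 2 \<le> s ^ 2" unfolding s2 by (simp add: power2_eq_square)
      then have "9 / 2 \<le> s" using s0 by (rule power2_le_imp_le)
      then have "9 * t \<le> 2 * s * t" using t0 by (intro mult_right_mono) auto
      then show ?thesis unfolding sq using mt by argo
    next
      case small: False
      then have "n = 3 \<or> n = 4 \<or> n = 5" using G(2) by (auto simp: n_def)
      then have n5: "n = 5" using False m_le s2 by auto
      have "1 \<le> s ^ 2" unfolding s2 n5 by simp
      then have "1 \<le> s" using s0 by (intro power2_le_imp_le[of 1 s]) auto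
      then have "2 * 1 \<le> 2 * s * t" using t1 by (intro mult_mono) auto
      moreover have "2 * m \<le> 20" using m_le n5 by simp
      moreover have "0 \<le> t ^ 2" by simp
      ultimately show ?thesis unfolding sq n5 by argo
    qed
  qed
  then have "sqrt (2 * m) \<le> t + s" using t0 s0 by (simp add: real_le_lsqrt)
  then show ?thesis by (simp add: t_def s_def h_def H_def)
qed

theorem theorem3:
  fixes V :: "'a set" and E :: "'a set set" and n m :: nat
  assumes "n \<ge> 3"
    and "simple_graph V E" and "connected_graph V E"
    and "card V = n" and "card E = m"
  shows "enat (nat \<lceil>real m / (3 * real n - 6 - sqrt (2 * real m) + sqrt (6 * (real n - 2)))\<rceil>)
           \<le> uncrossed_number V E"
proof -
  define B where "B = 3 * real n - 6 - sqrt (2 * real m) + sqrt (6 * (real n - 2))"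
  have finE: "finite E" using assms(2) by (rule simple_graph_finite_edges)
  have "B > 0"
  proof -
    have "2 * m \<le> n * (n - 1)" using simple_graph_card_edges_le[OF assms(2)] assms(4,5) by simp
    also have "\<dots> \<le> n ^ 2" by (simp add: power2_eq_square)
    finally have "real (2 * m) \<le> real (n ^ 2)" by (rule of_nat_mono)
    then have "sqrt (2 * real m) \<le> real n" by (intro real_le_lsqrt) auto
    moreover have "sqrt (6 * (real n - 2)) > 0" using assms(1) by simp
    ultimately show ?thesis using assms(1) unfolding B_def by linarith
  qed
  have "enat (nat \<lceil>real m / B\<rceil>) \<le> enat (card \<D>)"
    if "finite \<D>" and coll: "uncrossed_collection V E \<D>" for \<D>
  proof -
    have "E \<subseteq> (\<Union>D\<in>\<D>. {e \<in> E. uncrossed_in E D e})"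
      using coll by (auto simp: uncrossed_collection_def)
    then have "card E \<le> card (\<Union>D\<in>\<D>. {e \<in> E. uncrossed_in E D e})"
      using \<open>finite \<D>\<close> finE by (intro card_mono) auto
    also have "\<dots> \<le> (\<Sum>D\<in>\<D>. card {e \<in> E. uncrossed_in E D e})"
      using \<open>finite \<D>\<close> by (rule card_UN_le)
    finally have "real m \<le> (\<Sum>D\<in>\<D>. real (card {e \<in> E. uncrossed_in E D e}))"
      using assms(5) by (simp flip: of_nat_sum)
    also have "\<dots> \<le> (\<Sum>D\<in>\<D>. B)"
      using card_uncrossed_le[OF assms(2)] assms(1,4,5) coll
      by (intro sum_mono) (auto simp: B_def uncrossed_collection_def)
    finally have "real m / B \<le> real (card \<D>)"
      using \<open>B > 0\<close> by (simp add: divide_le_eq)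
    then show ?thesis by (simp add: ceiling_le_iff nat_le_iff)
  qed
  then show ?thesis unfolding uncrossed_number_def B_def[symmetric] by (intro INF_greatest) auto
qed

end
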